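(* Let $\phi$ be a Young function, $0\le\alpha<n$ and $1<p<\infty$, and let $A_1,\dots,A_m$ be invertible $n\times n$ matrices such that $A_i-A_j$ is invertible for $i\ne j$. Suppose that there exist Young functions $\mathcal E,\mathcal F$ such that $\mathcal E\in B_{p'}$ and $\mathcal E^{-1}(t)\mathcal F^{-1}(t)\le\phi^{-1}(t)$. Set $\mathcal D(t)=\mathcal F(t^{1/p})$. Let $T$ be a linear operator such that its adjoint $T^*$ satisfies: for all $0<q<\infty$ and $w\in A_\infty$ there is $c>0$ with $$\int_{\mathbb R^n}|T^*f(x)|^qw(x)\,dx\le c\int_{\mathbb R^n}\sum_{i=1}^m\big(M_{\alpha,\phi}f(A_ix)\big)^qw(x)\,dx$$ for all $f\in L_c^\infty(\mathbb R^n)$. Then for any weight $u$ there is $c>0$ such that for all $f\in L_c^\infty(\mathbb R^n)$ $$\int_{\mathbb R^n}|Tf(x)|^pu(x)\,dx\le c\int_{\mathbb R^n}|f(x)|^p\sum_{i=1}^mM_{\alpha p,\mathcal D}u(A_ix)\,dx.$$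
   Context: A Young function is a continuous, convex, nondecreasing $\Psi:[0,\infty)\to[0,\infty)$ with $\Psi(0)=0$ and $\lim_{t\to\infty}\Psi(t)=\infty$; $\Psi^{-1}$ is its (generalized) inverse. The Luxemburg average over a ball $B$ is $\|f\|_{\Psi,B}=\inf\{\lambda>0:\frac1{|B|}\int_B\Psi(|f|/\lambda)\le1\}$, and $M_{\beta,\Psi}f(x)=\sup_{B\ni x}|B|^{\beta/n}\|f\|_{\Psi,B}$ (supremum over balls containing $x$); $M_{\alpha p,\mathcal D}$ is given by the same formulas with $\beta=\alpha p$, $\Psi=\mathcal D$. For $1<s<\infty$, $\mathcal E\in B_s$ means $\int_1^\infty\frac{\mathcal E(t)}{t^s}\frac{dt}t<\infty$; $\frac1p+\frac1{p'}=1$. A weight is a nonnegative locally integrable function with values in $(0,\infty)$ a.e.; $A_\infty=\bigcup_{p\ge1}A_p$ with $A_p$ the Muckenhoupt classes. $L_c^\infty(\mathbb R^n)$ is the space of bounded compactly supported functions. $T^*$ is the adjoint of $T$ with respect to the pairing $\int fg$. *)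

theory Defs
  imports "HOL-Analysis.Analysis"
begin

section \<open>Young functions\<close>

text \<open>
  Functions on $[0,\infty)$ are total functions on the reals, of which only the values on
  \<open>{0..}\<close> are ever used.
\<close>

definition young_function :: "(real \<Rightarrow> real) \<Rightarrow> bool" where
  "young_function \<Psi> \<longleftrightarrow>
     (\<forall>t\<ge>0. 0 \<le> \<Psi> t) \<and> continuous_on {0..} \<Psi> \<and> convex_on {0..} \<Psi> \<and> mono_on {0..} \<Psi> \<and>
     \<Psi> 0 = 0 \<and> filterlim \<Psi> at_top at_top"

text \<open>
  The right-continuous generalized inverse. For a Young function and \<open>t > 0\<close> it is the unique
  \<open>s\<close> with \<open>\<Psi> s = t\<close>; the infimum over \<open>\<Psi> s \<ge> t\<close> could differ from it at \<open>t = 0\<close> only.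
\<close>

definition young_inverse :: "(real \<Rightarrow> real) \<Rightarrow> real \<Rightarrow> real" where
  "young_inverse \<Psi> t = Inf {s. 0 \<le> s \<and> t < \<Psi> s}"

definition B_class :: "real \<Rightarrow> (real \<Rightarrow> real) \<Rightarrow> bool" where
  "B_class s \<E> \<longleftrightarrow> (\<integral>\<^sup>+t\<in>{1..}. ennreal (\<E> t / t powr s / t) \<partial>lborel) < \<infinity>"


section \<open>Maximal operators\<close>

text \<open>Real powers of extended nonnegative numbers; meant for exponents \<open>q > 0\<close> only.\<close>

definition ennreal_powr :: "ennreal \<Rightarrow> real \<Rightarrow> ennreal" where
  "ennreal_powr x q = (if x = \<infinity> then \<infinity> else ennreal (enn2real x powr q))"

definition average :: "'a::euclidean_space set \<Rightarrow> ('a \<Rightarrow> ennreal) \<Rightarrow> ennreal" where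
  "average B g = (\<integral>\<^sup>+x\<in>B. g x \<partial>lebesgue) / emeasure lebesgue B"

text \<open>
  The value is \<open>\<infinity>\<close> if no \<open>\<lambda>\<close> is admissible. \<open>\<Psi>\<close> is not required to be a Young function, so
  that the definition also applies to the rescaled function \<open>t \<mapsto> \<F> (t powr (1/p))\<close>.
\<close>

definition luxemburg ::
  "(real \<Rightarrow> real) \<Rightarrow> 'a::euclidean_space set \<Rightarrow> ('a \<Rightarrow> 'b::real_normed_vector) \<Rightarrow> ennreal" where
  "luxemburg \<Psi> B f =
     Inf {ennreal l | l. 0 < l \<and> average B (\<lambda>x. ennreal (\<Psi> (norm (f x) / l))) \<le> 1}"

definition frac_maximal ::
  "real \<Rightarrow> (real \<Rightarrow> real) \<Rightarrow> ('a::euclidean_space \<Rightarrow> 'b::real_normed_vector) \<Rightarrow> 'a \<Rightarrow> ennreal" where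
  "frac_maximal \<beta> \<Psi> f x =
     (SUP B \<in> {ball y r | y r. 0 < r \<and> x \<in> ball y r}.
        ennreal (measure lebesgue B powr (\<beta> / DIM('a))) * luxemburg \<Psi> B f)"


section \<open>Weights\<close>

definition locally_integrable ::
  "('a::euclidean_space \<Rightarrow> 'b::{banach, second_countable_topology}) \<Rightarrow> bool" where
  "locally_integrable f \<longleftrightarrow>
     f \<in> borel_measurable lebesgue \<and> (\<forall>K. compact K \<longrightarrow> set_integrable lebesgue K f)"

definition weight :: "('a::euclidean_space \<Rightarrow> real) \<Rightarrow> bool" where
  "weight w \<longleftrightarrow> (\<forall>x. 0 \<le> w x) \<and> locally_integrable w \<and> (AE x in lebesgue. 0 < w x)"

text \<open>
  For \<open>p > 1\<close> the exponent \<open>-1/(p - 1)\<close> is \<open>1 - p'\<close>. The convention \<open>0 powr a = 0\<close> matters on a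
  null set only, since a weight is positive almost everywhere.
\<close>

definition muckenhoupt :: "real \<Rightarrow> ('a::euclidean_space \<Rightarrow> real) \<Rightarrow> bool" where
  "muckenhoupt p w \<longleftrightarrow> weight w \<and>
     (if p = 1
      then \<exists>C::real. \<forall>y r. 0 < r \<longrightarrow>
             (AE x in lebesgue. x \<in> ball y r \<longrightarrow>
                average (ball y r) (\<lambda>z. ennreal (w z)) \<le> ennreal (C * w x))
      else \<exists>C::real. \<forall>y r. 0 < r \<longrightarrow>
             average (ball y r) (\<lambda>z. ennreal (w z)) *
             ennreal_powr (average (ball y r) (\<lambda>z. ennreal (w z powr (- 1 / (p - 1))))) (p - 1)
               \<le> ennreal C)"

definition A_infinity :: "('a::euclidean_space \<Rightarrow> real) set" where
  "A_infinity = (\<Union>p\<in>{1..}. {w. muckenhoupt p w})"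


section \<open>Operators on bounded compactly supported functions\<close>

definition Lc_infty :: "('a::euclidean_space \<Rightarrow> 'b::real_normed_vector) set" where
  "Lc_infty = {f. f \<in> borel_measurable lebesgue \<and> bounded (range f) \<and> compact (closure {x. f x \<noteq> 0})}"

text \<open>
  Operators act on functions, and identities between functions hold almost everywhere. The values
  are locally integrable: this says exactly that the pairing $\int (Tf) g$ converges absolutely
  for all \<open>f\<close>, \<open>g\<close> in \<open>Lc_infty\<close>. The scalars of sort \<open>{real_normed_field, euclidean_space}\<close> are
  the reals or the complex numbers.
\<close>

definition linear_operator ::
  "(('a::euclidean_space \<Rightarrow> 'k::{real_normed_field, euclidean_space}) \<Rightarrow> 'a \<Rightarrow> 'k) \<Rightarrow> bool" where
  "linear_operator T \<longleftrightarrow>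
     (\<forall>f\<in>Lc_infty. locally_integrable (T f)) \<and>
     (\<forall>f\<in>Lc_infty. \<forall>g\<in>Lc_infty. AE x in lebesgue. T (\<lambda>y. f y + g y) x = T f x + T g x) \<and>
     (\<forall>a. \<forall>f\<in>Lc_infty. AE x in lebesgue. T (\<lambda>y. a * f y) x = a * T f x)"

text \<open>The adjoint for the bilinear pairing $\int f g$; there is no complex conjugation.\<close>

definition adjoint_operator ::
  "(('a::euclidean_space \<Rightarrow> 'k::{real_normed_field, euclidean_space}) \<Rightarrow> 'a \<Rightarrow> 'k) \<Rightarrow>
   (('a \<Rightarrow> 'k) \<Rightarrow> 'a \<Rightarrow> 'k) \<Rightarrow> bool" where
  "adjoint_operator T S \<longleftrightarrow>
     linear_operator S \<and>
     (\<forall>f\<in>Lc_infty. \<forall>g\<in>Lc_infty.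
        (\<integral>x. T f x * g x \<partial>lebesgue) = (\<integral>x. f x * S g x \<partial>lebesgue))"

end

theory Submission
  imports Defs
begin

text \<open>
  Write $U = u^{1/p}$, let $P$ be the maximal function $M_{\alpha,\mathcal F}U$, and let
  $Q(x) = \sum_i P(A_i x)^{1/2}$. Then $P^p \le M_{\alpha p,\mathcal D}u$, and $Q$ satisfies the $A_1$
  condition, so unless it is infinite everywhere its negative power $w = Q^{-2p'}$ is in $A_\infty$.
  By duality and Young's inequality it is enough to bound $\int |T^*h|^{p'} w$ by a multiple of
  $\int |h|^{p'} U^{-p'}$. The hypothesis on $T^*$ replaces $T^*h$ by $M_{\alpha,\phi}h$, the
  generalized Hoelder inequality gives $M_{\alpha,\phi}h \le 4 M_{\mathcal E}(h/U) P$, the factor $P$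
  cancels against $w$, and $M_{\mathcal E}$ is bounded on $L^{p'}$ because $\mathcal E \in B_{p'}$.
\<close>

section \<open>Powers of extended nonnegative reals\<close>

text \<open>The square root is there because \<open>P\<close> itself need not satisfy the A_1
  condition, while powers of a maximal function with exponent strictly between 0 and 1 do (the
  Coifman-Rochberg phenomenon). Any such exponent would serve; 1/2 is undone by the factor 2 in the
  exponents \<open>2 * p\<close> and \<open>2 * p'\<close>. The sum over i makes one weight serve
  all matrices. Since \<open>Q\<close> squared dominates every P(A_i x), the weight is at most P(A_i
  x) to the power -p' for each i, and this is what cancels on the dual side. On the side of f,
  Young's inequality leaves |f|^p times Q to the power 2p, which costs only a power of m against the
  sum of the P(A_i x)^p. \<open>\<D>\<close> need not be convex, so all estimates of maximal
  functions are made for \<open>\<F>\<close> and U, and \<open>\<D>\<close> enters only through the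
  pointwise comparison with P^p. T f is not known to have finite weighted norm. The dual estimate is
  therefore tested on truncations, and a free parameter in Young's inequality makes the coefficient
  of the term to be absorbed exactly 1/2. If P is infinite everywhere, the right-hand side is
  infinite unless f vanishes almost everywhere.\<close>

lemma ennreal_powr_ennreal: "0 \<le> a \<Longrightarrow> ennreal_powr (ennreal a) q = ennreal (a powr q)"
  by (simp add: ennreal_powr_def)

lemma ennreal_powr_top [simp]: "ennreal_powr top q = top"
  by (simp add: ennreal_powr_def)

lemma ennreal_powr_zero [simp]: "ennreal_powr 0 q = 0"
  by (simp add: ennreal_powr_def)

lemma ennreal_powr_eq_top_iff [simp]: "ennreal_powr x q = top \<longleftrightarrow> x = top"
  by (simp add: ennreal_powr_def)

lemma ennreal_powr_pos_iff [simp]: "0 < ennreal_powr x q \<longleftrightarrow> 0 < x"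
  by (cases x) (auto simp: ennreal_powr_ennreal)

lemma ennreal_powr_eq_0_iff [simp]: "ennreal_powr x q = 0 \<longleftrightarrow> x = 0"
  by (metis ennreal_powr_pos_iff not_gr_zero)

lemma ennreal_powr_mono: "0 \<le> q \<Longrightarrow> x \<le> y \<Longrightarrow> ennreal_powr x q \<le> ennreal_powr y q"
  by (cases x; cases y) (auto simp: ennreal_powr_ennreal powr_mono2 top_unique)

lemma ennreal_powr_mult: "ennreal_powr (x * y) q = ennreal_powr x q * ennreal_powr y q"
proof (cases "x = top \<or> y = top")
  case True
  show ?thesis
  proof (cases "x = 0 \<or> y = 0")
    case False
    with True show ?thesis
      by (auto simp: ennreal_mult_top ennreal_top_mult)
  qed auto
next
  case False
  then obtain a b where "x = ennreal a" "0 \<le> a" "y = ennreal b" "0 \<le> b"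
    by (cases x; cases y) auto
  then show ?thesis
    by (simp add: ennreal_powr_ennreal ennreal_mult[symmetric] powr_mult)
qed

lemma ennreal_powr_powr: "ennreal_powr (ennreal_powr x q) r = ennreal_powr x (q * r)"
  by (cases x) (simp_all add: ennreal_powr_ennreal powr_powr)

lemma ennreal_powr_one [simp]: "ennreal_powr x 1 = x"
  by (cases x) (simp_all add: ennreal_powr_ennreal)

lemma ennreal_powr_le_iff:
  assumes "0 < q"
  shows "ennreal_powr x q \<le> y \<longleftrightarrow> x \<le> ennreal_powr y (1 / q)"
proof
  assume "ennreal_powr x q \<le> y"
  then have "ennreal_powr (ennreal_powr x q) (1 / q) \<le> ennreal_powr y (1 / q)"
    using assms by (intro ennreal_powr_mono) auto
  then show "x \<le> ennreal_powr y (1 / q)" using assms by (simp add: ennreal_powr_powr)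
next
  assume "x \<le> ennreal_powr y (1 / q)"
  then have "ennreal_powr x q \<le> ennreal_powr (ennreal_powr y (1 / q)) q"
    using assms by (intro ennreal_powr_mono) auto
  then show "ennreal_powr x q \<le> y" using assms by (simp add: ennreal_powr_powr)
qed

lemma ennreal_powr_half_add:
  "ennreal_powr (x + y) (1 / 2) \<le> ennreal_powr x (1 / 2) + ennreal_powr y (1 / 2)"
proof (cases x; cases y)
  fix a b assume "x = ennreal a" "0 \<le> a" "y = ennreal b" "0 \<le> b"
  then show ?thesis
    using sqrt_add_le_add_sqrt[of a b]
    by (simp add: ennreal_powr_ennreal powr_half_sqrt ennreal_plus[symmetric] del: ennreal_plus)
qed auto

lemma borel_measurable_ennreal_powr [measurable (raw)]:
  assumes [measurable]: "f \<in> borel_measurable M"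
  shows "(\<lambda>x. ennreal_powr (f x) q) \<in> borel_measurable M"
  unfolding ennreal_powr_def by measurable

section \<open>Young functions\<close>

lemma young_nonneg: "young_function \<Psi> \<Longrightarrow> 0 \<le> t \<Longrightarrow> 0 \<le> \<Psi> t"
  by (simp add: young_function_def)

lemma young_mono: "young_function \<Psi> \<Longrightarrow> 0 \<le> s \<Longrightarrow> s \<le> t \<Longrightarrow> \<Psi> s \<le> \<Psi> t"
  unfolding young_function_def mono_on_def by auto

text \<open>Convexity on the segment from 0 to t together with \<Psi> 0 = 0. This is the only form
  in which convexity enters: it trades a factor in the argument for the same factor outside, as
  homogeneity would.\<close>

lemma young_scale:
  assumes \<Psi>: "young_function \<Psi>" and s: "0 \<le> s" "s \<le> 1" and t: "0 \<le> t"
  shows "\<Psi> (s * t) \<le> s * \<Psi> t"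
proof -
  have "convex_on {0..} \<Psi>" "\<Psi> 0 = 0" using \<Psi> by (auto simp: young_function_def)
  from convex_onD[OF this(1), of s 0 t] this(2) s t show ?thesis by simp
qed

lemma young_unbounded:
  assumes "young_function \<Psi>"
  obtains t where "0 < t" "K < \<Psi> t"
proof -
  have "filterlim \<Psi> at_top at_top" using assms by (simp add: young_function_def)
  then have "\<forall>\<^sub>F t in at_top. K < \<Psi> t" by (simp add: filterlim_at_top_dense)
  with eventually_gt_at_top[of 0] have "\<forall>\<^sub>F t in at_top. 0 < t \<and> K < \<Psi> t"
    by eventually_elim auto
  then show ?thesis using that eventually_happens'[OF trivial_limit_at_top_linorder] by blast
qed

text \<open>Nothing is known about \<Psi> at negative arguments, so measurability is obtained for
  the continuous extension \<open>\<Psi> (max 0 t)\<close>, which agrees with \<Psi> on the range of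
  f.\<close>

lemma young_measurable:
  assumes \<Psi>: "young_function \<Psi>" and [measurable]: "f \<in> borel_measurable M"
    and f: "\<And>x. x \<in> space M \<Longrightarrow> 0 \<le> f x"
  shows "(\<lambda>x. \<Psi> (f x)) \<in> borel_measurable M"
proof -
  have "continuous_on {0..} \<Psi>" using \<Psi> by (simp add: young_function_def)
  then have "continuous_on UNIV (\<lambda>t. \<Psi> (max 0 t))"
    by (rule continuous_on_compose2) (auto intro!: continuous_intros)
  then have [measurable]: "(\<lambda>t. \<Psi> (max 0 t)) \<in> borel_measurable borel"
    by (rule borel_measurable_continuous_onI)
  have "(\<lambda>x. \<Psi> (max 0 (f x))) \<in> borel_measurable M" by measurable
  then show ?thesis by (rule measurable_cong[THEN iffD1, rotated]) (simp add: f)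
qed

lemma young_inverse_ge:
  assumes \<Psi>: "young_function \<Psi>" and "0 \<le> a" "\<Psi> a \<le> t"
  shows "a \<le> young_inverse \<Psi> t"
  unfolding young_inverse_def
proof (rule cInf_greatest)
  show "{s. 0 \<le> s \<and> t < \<Psi> s} \<noteq> {}"
    using young_unbounded[OF \<Psi>, of t] by force
  fix s assume "s \<in> {s. 0 \<le> s \<and> t < \<Psi> s}"
  then show "a \<le> s" using young_mono[OF \<Psi>, of s a] assms(3) by force
qed

lemma young_less_inverse:
  assumes "0 \<le> s" "s < young_inverse \<Psi> t"
  shows "\<Psi> s \<le> t"
proof (rule ccontr)
  assume "\<not> \<Psi> s \<le> t"
  then have "young_inverse \<Psi> t \<le> s"
    unfolding young_inverse_def using assms(1) by (intro cInf_lower bdd_belowI[of _ 0]) auto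
  with assms(2) show False by simp
qed

text \<open>The factor 1/2 puts the argument strictly below the generalized inverse.\<close>

lemma young_product:
  assumes \<phi>: "young_function \<phi>" and \<E>: "young_function \<E>" and \<F>: "young_function \<F>"
    and inv: "\<forall>t\<ge>0. young_inverse \<E> t * young_inverse \<F> t \<le> young_inverse \<phi> t"
    and ab: "0 \<le> a" "0 \<le> b"
  shows "\<phi> (a * b / 2) \<le> \<E> a + \<F> b"
proof -
  \<comment> \<open>A single level at which both generalized inverses can be used: \<E> a and \<F> b
    are both at most t, so a and b lie below the respective inverses at t.\<close>
  define t where "t = max (\<E> a) (\<F> b)"
  have t0: "0 \<le> t" and t: "t \<le> \<E> a + \<F> b"
    using young_nonneg[OF \<E> ab(1)] young_nonneg[OF \<F> ab(2)] by (auto simp: t_def)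
  have "a \<le> young_inverse \<E> t" "b \<le> young_inverse \<F> t"
    using ab by (auto intro!: young_inverse_ge \<E> \<F> simp: t_def)
  then have "a * b \<le> young_inverse \<E> t * young_inverse \<F> t"
    using ab by (intro mult_mono) auto
  also have "\<dots> \<le> young_inverse \<phi> t" using inv t0 by auto
  finally have le: "a * b \<le> young_inverse \<phi> t" .
  have "\<phi> (a * b / 2) \<le> t"
  proof (cases "a * b = 0")
    case True
    then show ?thesis using \<phi> t0 by (simp only: young_function_def div_0)
  next
    case False
    then have "0 < a * b" using ab by (simp add: less_le)
    then show ?thesis using le by (intro young_less_inverse[of "a * b / 2" \<phi> t]) simp_all
  qed
  with t show ?thesis by simp
qed

section \<open>Luxemburg averages\<close>

lemma emeasure_lebesgue_ball_pos: "0 < r \<Longrightarrow> 0 < emeasure lebesgue (ball y r)"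
  for y :: "'a::euclidean_space"
  by (simp add: emeasure_ball) 

lemma emeasure_lebesgue_ball_finite: "emeasure lebesgue (ball y r) < \<infinity>"
  for y :: "'a::euclidean_space"
  using emeasure_lborel_ball_finite[of y r] by simp

lemma emeasure_lebesgue_ball_scale:
  fixes y z :: "'a::euclidean_space"
  assumes "0 < r" "0 \<le> c"
  shows "emeasure lebesgue (ball y (c * r)) = ennreal (c ^ DIM('a)) * emeasure lebesgue (ball z r)"
proof -
  have "emeasure lebesgue (ball y (c * r)) = ennreal (unit_ball_vol (real DIM('a)) * (c * r) ^ DIM('a))"
    using assms by (simp add: emeasure_ball)
  also have "\<dots> = ennreal (c ^ DIM('a) * (unit_ball_vol (real DIM('a)) * r ^ DIM('a)))"
    by (simp add: power_mult_distrib mult_ac)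
  also have "\<dots> = ennreal (c ^ DIM('a)) * emeasure lebesgue (ball z r)"
    using assms by (simp add: ennreal_mult' emeasure_ball)
  finally show ?thesis .
qed

lemma average_le_iff:
  fixes g :: "'a::euclidean_space \<Rightarrow> ennreal"
  assumes "0 < r"
  shows "average (ball y r) g \<le> c \<longleftrightarrow> (\<integral>\<^sup>+x\<in>ball y r. g x \<partial>lebesgue) \<le> c * emeasure lebesgue (ball y r)"
proof -
  have *: "emeasure lebesgue (ball y r) \<noteq> 0" "emeasure lebesgue (ball y r) \<noteq> top"
    using emeasure_lebesgue_ball_pos[OF assms, of y] emeasure_lebesgue_ball_finite[of y r] by auto
  have eq: "average (ball y r) g * emeasure lebesgue (ball y r) = (\<integral>\<^sup>+x\<in>ball y r. g x \<partial>lebesgue)"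
    unfolding average_def ennreal_divide_times using * by (simp add: top.not_eq_extremum)
  show ?thesis
    unfolding eq[symmetric] mult.commute[of _ "emeasure lebesgue (ball y r)"]
    using * by (simp only: ennreal_mult_le_mult_iff not_False_eq_True)
qed

text \<open>Intended for e a Luxemburg infimum: information is available only for real l strictly
  above e, and letting l decrease to e gives the bound. The case e = top is trivial because c is
  positive.\<close>

lemma ennreal_le_multI:
  assumes c: "0 < c" and le: "\<And>l. 0 < l \<Longrightarrow> e < ennreal l \<Longrightarrow> X \<le> ennreal (c * l)"
  shows "X \<le> ennreal c * e"
proof (cases e)
  case (real e0)
  show ?thesis
  proof (rule ennreal_le_epsilon)
    fix d :: real assume d: "0 < d"
    have "X \<le> ennreal (c * (e0 + d / c))"
      using c d real by (intro le) (auto simp: add_nonneg_pos ennreal_less_iff)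
    also have "\<dots> = ennreal c * e + ennreal d"
      using c d real by (simp add: ring_distribs ennreal_mult)
    finally show "X \<le> ennreal c * e + ennreal d" .
  qed
next
  case top
  with c show ?thesis by (simp add: ennreal_mult_top)
qed

lemma luxemburg_le:
  assumes "0 < l" "0 < r"
    and "(\<integral>\<^sup>+x\<in>ball y r. ennreal (\<Psi> (norm (f x) / l)) \<partial>lebesgue) \<le> emeasure lebesgue (ball y r)"
  shows "luxemburg \<Psi> (ball y r) f \<le> ennreal l"
  unfolding luxemburg_def using assms by (intro Inf_lower) (auto simp: average_le_iff)

text \<open>The admissible parameters form an upward closed set because \<Psi> is monotone. Working
  strictly above the infimum avoids the question whether it is attained.\<close>

lemma luxemburg_less:
  assumes \<Psi>: "young_function \<Psi>" and r: "0 < r" and less: "luxemburg \<Psi> (ball y r) f < ennreal l"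
  shows "(\<integral>\<^sup>+x\<in>ball y r. ennreal (\<Psi> (norm (f x) / l)) \<partial>lebesgue) \<le> emeasure lebesgue (ball y r)"
proof -
  obtain k where k: "0 < k" "ennreal k < ennreal l"
      "average (ball y r) (\<lambda>x. ennreal (\<Psi> (norm (f x) / k))) \<le> 1"
    using less unfolding luxemburg_def Inf_less_iff by auto
  have kl: "k \<le> l" using k(1,2) by (simp add: ennreal_less_iff)
  have "\<Psi> (norm (f x) / l) \<le> \<Psi> (norm (f x) / k)" for x
    using k(1) kl by (intro young_mono[OF \<Psi>] divide_nonneg_pos divide_left_mono) auto
  then have "(\<integral>\<^sup>+x\<in>ball y r. ennreal (\<Psi> (norm (f x) / l)) \<partial>lebesgue)
      \<le> (\<integral>\<^sup>+x\<in>ball y r. ennreal (\<Psi> (norm (f x) / k)) \<partial>lebesgue)"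
    by (intro nn_integral_mono mult_right_mono ennreal_leI) auto
  also have "\<dots> \<le> emeasure lebesgue (ball y r)" using k(3) r by (simp add: average_le_iff)
  finally show ?thesis .
qed

lemma young_lebesgue_measurable:
  assumes \<Psi>: "young_function \<Psi>" and [measurable]: "f \<in> borel_measurable lebesgue" and l: "0 < l"
  shows "(\<lambda>x. ennreal (\<Psi> (norm (f x) / l))) \<in> borel_measurable lebesgue"
proof -
  have "(\<lambda>x. \<Psi> (norm (f x) / l)) \<in> borel_measurable lebesgue"
    by (rule young_measurable[OF \<Psi>]) (use l in simp_all)
  then show ?thesis by (rule measurable_compose[OF _ measurable_ennreal])
qed

lemma young_ball_measurable:
  assumes "young_function \<Psi>" "f \<in> borel_measurable lebesgue" "0 < l"
  shows "(\<lambda>x. ennreal (\<Psi> (norm (f x) / l)) * indicator (ball y r) x) \<in> borel_measurable lebesgue"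
  by (rule borel_measurable_times_ennreal[OF young_lebesgue_measurable[OF assms] borel_measurable_indicator]) simp

text \<open>The constant 4 is 2 times 2: one factor is the 1/2 in \<open>young_product\<close>, the
  other compensates for adding two modulars, each bounded by the measure of the ball. The assumption
  \<open>fin\<close> keeps the product on the right from having the form top * 0, which is
  0.\<close>

lemma luxemburg_hoelder:
  fixes h :: "'a::euclidean_space \<Rightarrow> 'b::real_normed_vector" and a b :: "'a \<Rightarrow> real"
  assumes \<phi>: "young_function \<phi>" and \<E>: "young_function \<E>" and \<F>: "young_function \<F>"
    and inv: "\<forall>t\<ge>0. young_inverse \<E> t * young_inverse \<F> t \<le> young_inverse \<phi> t"
    and a[measurable]: "a \<in> borel_measurable lebesgue" and b[measurable]: "b \<in> borel_measurable lebesgue"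
    and ab: "AE x in lebesgue. norm (h x) = norm (a x) * norm (b x)"
    and r: "0 < r"
    and fin: "0 < luxemburg \<F> (ball y r) b" "luxemburg \<F> (ball y r) b < \<infinity>"
  shows "luxemburg \<phi> (ball y r) h \<le> 4 * luxemburg \<E> (ball y r) a * luxemburg \<F> (ball y r) b"
proof -
  let ?B = "ball y r"
  have key: "luxemburg \<phi> ?B h \<le> ennreal (4 * k * l)"
    if "0 < k" "luxemburg \<E> ?B a < ennreal k" "0 < l" "luxemburg \<F> ?B b < ennreal l" for k l
  proof (rule luxemburg_le)
    note meas = young_ball_measurable[OF \<E> a that(1), of y r] young_ball_measurable[OF \<F> b that(3), of y r]
    have "AE x in lebesgue. ennreal (\<phi> (norm (h x) / (4 * k * l))) * indicator ?B x
       \<le> ennreal (1 / 2) * (ennreal (\<E> (norm (a x) / k)) * indicator ?B x + ennreal (\<F> (norm (b x) / l)) * indicator ?B x)"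
      using ab
    proof eventually_elim
      fix x assume x: "norm (h x) = norm (a x) * norm (b x)"
      have pos: "0 \<le> norm (a x) / k" "0 \<le> norm (b x) / l" using that by auto
      have "norm (h x) / (4 * k * l) = (1 / 2) * ((norm (a x) / k) * (norm (b x) / l) / 2)"
        using that x by (simp add: field_simps)
      then have "\<phi> (norm (h x) / (4 * k * l)) \<le> (1 / 2) * \<phi> ((norm (a x) / k) * (norm (b x) / l) / 2)"
        using young_scale[OF \<phi>, of "1/2" "(norm (a x) / k) * (norm (b x) / l) / 2"] that by simp
      also have "\<dots> \<le> (1 / 2) * (\<E> (norm (a x) / k) + \<F> (norm (b x) / l))"
        using young_product[OF \<phi> \<E> \<F> inv pos] by simp
      finally have "ennreal (\<phi> (norm (h x) / (4 * k * l)))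
          \<le> ennreal ((1 / 2) * (\<E> (norm (a x) / k) + \<F> (norm (b x) / l)))" by (rule ennreal_leI)
      also have "\<dots> = ennreal (1 / 2) * (ennreal (\<E> (norm (a x) / k)) + ennreal (\<F> (norm (b x) / l)))"
        using young_nonneg[OF \<E> pos(1)] young_nonneg[OF \<F> pos(2)]
        by (subst ennreal_mult, simp, simp, subst ennreal_plus) simp_all
      finally show "ennreal (\<phi> (norm (h x) / (4 * k * l))) * indicator ?B x
         \<le> ennreal (1 / 2) * (ennreal (\<E> (norm (a x) / k)) * indicator ?B x + ennreal (\<F> (norm (b x) / l)) * indicator ?B x)"
        by (auto simp: indicator_def)
    qed
    then have "(\<integral>\<^sup>+x\<in>?B. ennreal (\<phi> (norm (h x) / (4 * k * l))) \<partial>lebesgue) \<le>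
       (\<integral>\<^sup>+x. ennreal (1 / 2) * (ennreal (\<E> (norm (a x) / k)) * indicator ?B x + ennreal (\<F> (norm (b x) / l)) * indicator ?B x) \<partial>lebesgue)"
      by (rule nn_integral_mono_AE)
    also have "\<dots> = ennreal (1 / 2) * ((\<integral>\<^sup>+x\<in>?B. ennreal (\<E> (norm (a x) / k)) \<partial>lebesgue)
        + (\<integral>\<^sup>+x\<in>?B. ennreal (\<F> (norm (b x) / l)) \<partial>lebesgue))"
      using meas by (simp only: nn_integral_cmult nn_integral_add borel_measurable_add)
    also have "\<dots> \<le> ennreal (1 / 2) * (emeasure lebesgue ?B + emeasure lebesgue ?B)"
      by (intro mult_left_mono add_mono luxemburg_less[OF \<E> r that(2)] luxemburg_less[OF \<F> r that(4)]) simp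
    also have "\<dots> = (ennreal (1/2) * 2) * emeasure lebesgue ?B"
      by (simp only: mult_2[symmetric] mult.assoc)
    also have "ennreal (1/2) * 2 = ennreal (1/2 * 2)" by (subst ennreal_mult) auto
    finally show "(\<integral>\<^sup>+x\<in>?B. ennreal (\<phi> (norm (h x) / (4 * k * l))) \<partial>lebesgue) \<le> emeasure lebesgue ?B"
      by simp
  qed (use that r in auto)
  obtain e where e: "luxemburg \<F> ?B b = ennreal e" "0 < e"
    using fin by (cases "luxemburg \<F> ?B b") auto
  have "luxemburg \<phi> ?B h \<le> ennreal (4 * e * k)" if k: "0 < k" "luxemburg \<E> ?B a < ennreal k" for k
  proof -
    have "luxemburg \<phi> ?B h \<le> ennreal (4 * k) * luxemburg \<F> ?B b"
      using k key by (intro ennreal_le_multI) auto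
    also have "\<dots> = ennreal (4 * e * k)"
      unfolding e(1) using k e(2) by (simp add: ennreal_mult[symmetric] mult_ac)
    finally show ?thesis .
  qed
  then have "luxemburg \<phi> ?B h \<le> ennreal (4 * e) * luxemburg \<E> ?B a"
    using e by (intro ennreal_le_multI) auto
  also have "\<dots> = 4 * luxemburg \<E> ?B a * luxemburg \<F> ?B b"
    unfolding e(1) using e(2) by (simp add: ennreal_mult' mult_ac)
  finally show ?thesis .
qed

text \<open>If the average were 0, every l would be admissible. By convexity \<Psi>(n s) is at least
  n \<Psi>(s), so n times the modular at l stays below the measure of the ball for all n, which
  forces the modular to vanish. This positivity later excludes products of 0 and infinity and keeps
  negative powers of maximal functions meaningful.\<close>

lemma luxemburg_pos:
  fixes f :: "'a::euclidean_space \<Rightarrow> 'b::{real_normed_vector,second_countable_topology}"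
  assumes \<Psi>: "young_function \<Psi>" and f: "f \<in> borel_measurable lebesgue"
    and pos: "AE x in lebesgue. f x \<noteq> 0" and r: "0 < r"
  shows "0 < luxemburg \<Psi> (ball y r) f"
proof (rule ccontr)
  let ?B = "ball y r"
  assume "\<not> 0 < luxemburg \<Psi> ?B f"
  then have zero_norm: "luxemburg \<Psi> ?B f = 0" by simp
  have le: "(\<integral>\<^sup>+x\<in>?B. ennreal (\<Psi> (norm (f x) / l)) \<partial>lebesgue) \<le> emeasure lebesgue ?B" if "0 < l" for l
    by (rule luxemburg_less[OF \<Psi> r]) (use zero_norm that in simp)
  note meas = young_ball_measurable[OF \<Psi> f, of _ y r]
  have zero: "(\<integral>\<^sup>+x\<in>?B. ennreal (\<Psi> (norm (f x) / l)) \<partial>lebesgue) = 0" if l: "0 < l" for l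
  proof (rule ccontr)
    let ?I = "\<integral>\<^sup>+x\<in>?B. ennreal (\<Psi> (norm (f x) / l)) \<partial>lebesgue"
    assume "?I \<noteq> 0"
    have bd: "of_nat n * ?I \<le> emeasure lebesgue ?B" if n: "0 < n" for n :: nat
    proof -
      have "of_nat n * ?I = (\<integral>\<^sup>+x. of_nat n * (ennreal (\<Psi> (norm (f x) / l)) * indicator ?B x) \<partial>lebesgue)"
        by (rule nn_integral_cmult[symmetric, OF meas[OF l]])
      also have "\<dots> \<le> (\<integral>\<^sup>+x\<in>?B. ennreal (\<Psi> (norm (f x) / (l / n))) \<partial>lebesgue)"
      proof (intro nn_integral_mono)
        fix x
        have "\<Psi> ((1 / n) * (norm (f x) / (l / n))) \<le> (1 / n) * \<Psi> (norm (f x) / (l / n))"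
          using l n by (intro young_scale[OF \<Psi>]) auto
        then have "real n * \<Psi> (norm (f x) / l) \<le> \<Psi> (norm (f x) / (l / n))"
          using n by (simp add: field_simps)
        then have "of_nat n * ennreal (\<Psi> (norm (f x) / l)) \<le> ennreal (\<Psi> (norm (f x) / (l / n)))"
          by (metis ennreal_leI ennreal_mult' ennreal_of_nat_eq_real_of_nat of_nat_0_le_iff)
        then show "of_nat n * (ennreal (\<Psi> (norm (f x) / l)) * indicator ?B x)
            \<le> ennreal (\<Psi> (norm (f x) / (l / n))) * indicator ?B x"
          by (auto simp: indicator_def)
      qed
      also have "\<dots> \<le> emeasure lebesgue ?B" using l n by (intro le) auto
      finally show ?thesis .
    qed
    then have "?I \<noteq> top" using emeasure_lebesgue_ball_finite[of y r]
      using bd[of 1] by (auto simp: top_unique)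
    then obtain i where i: "?I = ennreal i" "0 < i" using \<open>?I \<noteq> 0\<close> by (cases ?I) auto
    obtain v where v: "emeasure lebesgue ?B = ennreal v" "0 \<le> v"
      using emeasure_lebesgue_ball_finite[of y r] by (cases "emeasure lebesgue ?B") auto
    obtain n :: nat where n: "v < real n * i" using ex_less_of_nat_mult[OF i(2)] by auto
    moreover have "0 < n" using n v(2) by (cases n) auto
    ultimately show False
      using bd[of n] unfolding i v ennreal_of_nat_eq_real_of_nat
      using i(2) v(2) by (simp add: ennreal_mult[symmetric])
  qed
  \<comment> \<open>A single l is not enough, since \<Psi> may vanish near 0. All scales 1/(n+1) are
    taken at once outside one null set; then \<Psi> would vanish at arbitrarily large
    arguments.\<close>
  have "AE x in lebesgue. \<forall>n::nat. x \<in> ?B \<longrightarrow> \<Psi> (norm (f x) / (1 / Suc n)) \<le> 0"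
  proof (rule AE_all_countable[THEN iffD2], intro allI)
    fix n :: nat
    have "0 < 1 / real (Suc n)" by simp
    note zero[OF this] meas[OF this]
    then show "AE x in lebesgue. x \<in> ?B \<longrightarrow> \<Psi> (norm (f x) / (1 / Suc n)) \<le> 0"
      by (subst (asm) nn_integral_0_iff_AE) (auto simp: indicator_def ennreal_eq_0_iff elim!: eventually_mono split: if_splits)
  qed
  with pos have "AE x in lebesgue. x \<notin> ?B"
  proof eventually_elim
    fix x assume x: "f x \<noteq> 0" "\<forall>n::nat. x \<in> ?B \<longrightarrow> \<Psi> (norm (f x) / (1 / Suc n)) \<le> 0"
    show "x \<notin> ?B"
    proof
      assume "x \<in> ?B"
      obtain t where t: "0 < t" "0 < \<Psi> t" using young_unbounded[OF \<Psi>] by blast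
      have "0 < norm (f x)" using x by simp
      then obtain n :: nat where "t < real n * norm (f x)" using ex_less_of_nat_mult by blast
      also have "\<dots> \<le> norm (f x) / (1 / Suc n)" by (simp add: algebra_simps)
      finally have "\<Psi> t \<le> \<Psi> (norm (f x) / (1 / Suc n))"
        using t by (intro young_mono[OF \<Psi>]) auto
      then show False using x(2)[rule_format, of n] \<open>x \<in> ?B\<close> t by simp
    qed
  qed
  then have "emeasure lebesgue ?B = 0"
    by (subst (asm) AE_iff_measurable[of ?B]) auto
  then show False using emeasure_lebesgue_ball_pos[OF r, of y] by simp
qed

text \<open>The factor \<open>c ^ DIM('a)\<close> is the ratio of the measures of the two balls.
  Convexity moves it inside \<Psi>, so it appears as a multiple of the parameter l.\<close>

lemma luxemburg_enlarge:
  fixes y z :: "'a::euclidean_space" and f :: "'a \<Rightarrow> 'b::{real_normed_vector,second_countable_topology}"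
  assumes \<Psi>: "young_function \<Psi>" and f[measurable]: "f \<in> borel_measurable lebesgue"
    and r: "0 < r" and c: "1 \<le> c" and sub: "ball y r \<subseteq> ball z (c * r)"
  shows "luxemburg \<Psi> (ball y r) f \<le> ennreal (c ^ DIM('a)) * luxemburg \<Psi> (ball z (c * r)) f"
  proof (rule ennreal_le_multI)
  let ?c = "c ^ DIM('a)"
  have c1: "1 \<le> ?c" using c by (rule one_le_power)
  then show c0: "0 < ?c" by linarith
  fix l :: real assume l: "0 < l" "luxemburg \<Psi> (ball z (c * r)) f < ennreal l"
  show "luxemburg \<Psi> (ball y r) f \<le> ennreal (?c * l)"
  proof (rule luxemburg_le)
    have le: "?c * \<Psi> (norm (f x) / (?c * l)) \<le> \<Psi> (norm (f x) / l)" for x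
      using young_scale[OF \<Psi>, of "1 / ?c" "norm (f x) / l"] c1 l(1) c0
      by (simp add: field_simps)
    have "ennreal ?c * (\<integral>\<^sup>+x\<in>ball y r. ennreal (\<Psi> (norm (f x) / (?c * l))) \<partial>lebesgue)
        = (\<integral>\<^sup>+x. ennreal ?c * (ennreal (\<Psi> (norm (f x) / (?c * l))) * indicator (ball y r) x) \<partial>lebesgue)"
      using c0 l by (intro nn_integral_cmult[symmetric] young_ball_measurable[OF \<Psi> f]) auto
    also have "\<dots> \<le> (\<integral>\<^sup>+x\<in>ball z (c * r). ennreal (\<Psi> (norm (f x) / l)) \<partial>lebesgue)"
    proof (rule nn_integral_mono)
      fix x
      have "ennreal ?c * ennreal (\<Psi> (norm (f x) / (?c * l))) \<le> ennreal (\<Psi> (norm (f x) / l))"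
        using le[of x] c0 by (simp add: ennreal_mult'[symmetric] ennreal_leI)
      then show "ennreal ?c * (ennreal (\<Psi> (norm (f x) / (?c * l))) * indicator (ball y r) x)
          \<le> ennreal (\<Psi> (norm (f x) / l)) * indicator (ball z (c * r)) x"
        using sub by (auto simp: indicator_def)
    qed
    also have "\<dots> \<le> emeasure lebesgue (ball z (c * r))"
      by (rule luxemburg_less[OF \<Psi> _ l(2)]) (use r c in simp)
    also have "\<dots> = ennreal ?c * emeasure lebesgue (ball y r)"
      using r c by (intro emeasure_lebesgue_ball_scale) auto
    finally show "(\<integral>\<^sup>+x\<in>ball y r. ennreal (\<Psi> (norm (f x) / (?c * l))) \<partial>lebesgue)
        \<le> emeasure lebesgue (ball y r)"
      using c1 by (subst (asm) ennreal_mult_le_mult_iff) (simp_all add: ennreal_eq_0_iff)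
  qed (use c0 l r in auto)
qed

section \<open>Covering and distribution functions\<close>

lemma sigma_finite_lebesgue: "sigma_finite_measure (lebesgue :: 'a::euclidean_space measure)"
proof
  have "\<exists>n. x \<in> ball 0 (real n)" for x :: 'a
    using reals_Archimedean2[of "norm x"] by simp
  then show "\<exists>A::'a set set. countable A \<and> A \<subseteq> sets lebesgue \<and> \<Union>A = space lebesgue \<and>
      (\<forall>a\<in>A. emeasure lebesgue a \<noteq> \<infinity>)"
    using emeasure_lebesgue_ball_finite
    by (intro exI[of _ "range (\<lambda>n. ball 0 (real n))"]) (auto simp: less_top[symmetric])
qed

text \<open>Vitali's covering lemma: the selected balls are disjoint, so their integrals of h add
  up, and their fivefold dilates cover S. The measure N is kept general because the lemma serves
  both the weak type estimates (N Lebesgue measure) and the change of variables (N the image of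
  Lebesgue measure under a matrix). S need not be measurable; only the union of the dilates
  is.\<close>

lemma measure_le_of_ball_cover:
  fixes h :: "'a::euclidean_space \<Rightarrow> ennreal"
  assumes h: "h \<in> borel_measurable lebesgue" and N: "sets borel \<subseteq> sets N" and c: "0 < c"
    and doubling: "\<And>y r. 0 < r \<Longrightarrow> emeasure N (ball y (5 * r)) \<le> ennreal c * emeasure lebesgue (ball y r)"
    and cover: "\<And>x. x \<in> S \<Longrightarrow> \<exists>y r. 0 < r \<and> x \<in> ball y r \<and>
      emeasure lebesgue (ball y r) \<le> (\<integral>\<^sup>+z\<in>ball y r. h z \<partial>lebesgue)"
  shows "emeasure N S \<le> ennreal c * (\<integral>\<^sup>+z. h z \<partial>lebesgue)"
proof (cases "(\<integral>\<^sup>+z. h z \<partial>lebesgue) = top")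
  case True
  with c show ?thesis by (simp add: ennreal_mult_top ennreal_eq_0_iff)
next
  case False
  then obtain i where i: "(\<integral>\<^sup>+z. h z \<partial>lebesgue) = ennreal i" "0 \<le> i"
    by (cases "\<integral>\<^sup>+z. h z \<partial>lebesgue") auto
  define K where "K = {(y::'a, r::real). 0 < r \<and> emeasure lebesgue (ball y r) \<le> (\<integral>\<^sup>+z\<in>ball y r. h z \<partial>lebesgue)}"
  let ?B = "\<lambda>c p. ball (fst p) (c * snd p) :: 'a set"
  define v where "v = unit_ball_vol (real DIM('a))"
  have v: "0 < v" by (simp add: v_def)
  \<comment> \<open>Vitali's lemma needs bounded radii. Each ball of K has measure at most the total
    integral i, so v times the n-th power of its radius is at most i, and a radius r \<ge> 1 is at
    most its n-th power.\<close>
  have bdd: "0 < snd p \<and> snd p \<le> max 1 (i / v)" if p: "p \<in> K" for p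
  proof -
    obtain y r where p': "p = (y, r)" by (cases p)
    have r: "0 < r" "emeasure lebesgue (ball y r) \<le> (\<integral>\<^sup>+z\<in>ball y r. h z \<partial>lebesgue)"
      using p by (auto simp: K_def p')
    note r(2)
    also have "(\<integral>\<^sup>+z\<in>ball y r. h z \<partial>lebesgue) \<le> ennreal i"
      unfolding i(1)[symmetric] by (intro nn_integral_mono) (auto simp: indicator_def)
    finally have "v * r ^ DIM('a) \<le> i"
      using r(1) i(2) v by (simp add: emeasure_ball v_def)
    then have le: "r ^ DIM('a) \<le> i / v" using v by (simp add: field_simps)
    have "r \<le> max 1 (i / v)"
    proof (cases "1 \<le> r")
      case True
      then have "r ^ 1 \<le> r ^ DIM('a)" by (intro power_increasing) auto
      with le show ?thesis by simp
    qed simp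
    with r(1) show ?thesis by (simp add: p')
  qed
  have "S \<subseteq> (\<Union>p\<in>K. ball (fst p) (snd p))"
    using cover by (force simp: K_def)
  from Vitali_covering_lemma_balls[OF this bdd] obtain C where C: "countable C" "C \<subseteq> K"
      "pairwise (\<lambda>i j. disjnt (ball (fst i) (snd i)) (ball (fst j) (snd j))) C"
      "S \<subseteq> (\<Union>p\<in>C. ball (fst p) (5 * snd p))" by blast
  \<comment> \<open>The countable family, possibly finite, as a sequence of sets: indices that do
    not occur carry the empty set. \<open>X 1\<close> lists the selected balls, \<open>X 5\<close>
    their dilates.\<close>
  define X where "X c n = (if n \<in> to_nat_on C ` C then ?B c (from_nat_into C n) else {})" for c n
  have X_leb: "X c n \<in> sets lebesgue" for c n by (simp add: X_def)
  have X_sets: "X c n \<in> sets N" for c n using N by (auto simp: X_def)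
  have Xh: "(\<lambda>z. h z * indicator (X c n) z) \<in> borel_measurable lebesgue" for c n
    by (intro borel_measurable_times_ennreal h borel_measurable_indicator X_leb)
  have X_in: "from_nat_into C n \<in> K" if "n \<in> to_nat_on C ` C" for n
    using that C(1,2) by auto
  have disj: "disjoint_family (X 1)"
    unfolding disjoint_family_on_def
  proof (intro ballI impI)
    fix m n :: nat assume "m \<noteq> n"
    show "X 1 m \<inter> X 1 n = {}"
    proof (cases "m \<in> to_nat_on C ` C \<and> n \<in> to_nat_on C ` C")
      case True
      then obtain a b where ab: "a \<in> C" "b \<in> C" "m = to_nat_on C a" "n = to_nat_on C b" by blast
      with \<open>m \<noteq> n\<close> have "a \<noteq> b" by auto
      with ab C(1) C(3) show ?thesis
        by (auto simp: X_def pairwise_def disjnt_def)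
    qed (auto simp: X_def)
  qed
  have "emeasure N S \<le> emeasure N (\<Union>n. X 5 n)"
  proof (intro emeasure_mono subsetI)
    fix x assume "x \<in> S"
    with C(4) obtain p where p: "p \<in> C" "x \<in> ?B 5 p" by blast
    then have "x \<in> X 5 (to_nat_on C p)" using C(1) by (simp add: X_def)
    then show "x \<in> (\<Union>n. X 5 n)" by blast
  qed (use X_sets in auto)
  also have "\<dots> \<le> (\<Sum>n. emeasure N (X 5 n))"
    by (rule emeasure_subadditive_countably) (use X_sets in auto)
  also have "\<dots> \<le> (\<Sum>n. ennreal c * (\<integral>\<^sup>+z\<in>X 1 n. h z \<partial>lebesgue))"
  proof (intro suminf_le allI summableI)
    fix n
    show "emeasure N (X 5 n) \<le> ennreal c * (\<integral>\<^sup>+z\<in>X 1 n. h z \<partial>lebesgue)"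
    proof (cases "n \<in> to_nat_on C ` C")
      case True
      obtain y r where p: "from_nat_into C n = (y, r)" by (cases "from_nat_into C n")
      with X_in[OF True] have r: "0 < r" "emeasure lebesgue (ball y r) \<le> (\<integral>\<^sup>+z\<in>ball y r. h z \<partial>lebesgue)"
        by (auto simp: K_def)
      have "emeasure N (X 5 n) \<le> ennreal c * emeasure lebesgue (ball y r)"
        using True p doubling[OF r(1), of y] by (simp only: X_def) simp
      also have "\<dots> \<le> ennreal c * (\<integral>\<^sup>+z\<in>X 1 n. h z \<partial>lebesgue)"
        using r(2) True p by (intro mult_left_mono) (simp_all add: X_def)
      finally show ?thesis .
    qed (simp add: X_def)
  qed
  also have "\<dots> = ennreal c * (\<Sum>n. (\<integral>\<^sup>+z\<in>X 1 n. h z \<partial>lebesgue))"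
    by (rule ennreal_suminf_cmult)
  also have "(\<Sum>n. (\<integral>\<^sup>+z\<in>X 1 n. h z \<partial>lebesgue)) = (\<integral>\<^sup>+z. (\<Sum>n. h z * indicator (X 1 n) z) \<partial>lebesgue)"
    by (intro nn_integral_suminf[symmetric] Xh)
  also have "\<dots> = (\<integral>\<^sup>+z. h z * indicator (\<Union>n. X 1 n) z \<partial>lebesgue)"
    using disj by (simp add: suminf_indicator)
  also have "\<dots> \<le> (\<integral>\<^sup>+z. h z \<partial>lebesgue)"
    by (intro nn_integral_mono) (auto simp: indicator_def)
  finally show ?thesis by (simp add: mult_left_mono)
qed

lemma emeasure_le_of_ball_cover:
  fixes h :: "'a::euclidean_space \<Rightarrow> ennreal"
  assumes "h \<in> borel_measurable lebesgue"
    and "\<And>x. x \<in> S \<Longrightarrow> \<exists>y r. 0 < r \<and> x \<in> ball y r \<and>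
      emeasure lebesgue (ball y r) \<le> (\<integral>\<^sup>+z\<in>ball y r. h z \<partial>lebesgue)"
  shows "emeasure lebesgue S \<le> ennreal (5 ^ DIM('a)) * (\<integral>\<^sup>+z. h z \<partial>lebesgue)"
proof (rule measure_le_of_ball_cover[OF assms(1) _ _ _ assms(2)])
  show "emeasure lebesgue (ball y (5 * r)) \<le> ennreal (5 ^ DIM('a)) * emeasure lebesgue (ball y r)"
    if "0 < r" for y :: 'a and r
    by (rule eq_refl, rule emeasure_lebesgue_ball_scale[OF that]) simp
qed auto

text \<open>The substitution that replaces g t by t. The measure t^(-q-1) dt is the layer-cake
  measure \<lambda>^(q-1) d\<lambda> in the variable t = 1/\<lambda>. Reciprocal levels let modulars
  appear as \<Psi>(|f| t), without division.\<close>

lemma nn_integral_powr_scale: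
  fixes H :: "real \<Rightarrow> ennreal"
  assumes [measurable]: "H \<in> borel_measurable borel" and g: "0 < g"
  shows "(\<integral>\<^sup>+t\<in>{0<..}. ennreal (t powr (- q - 1)) * H (g * t) \<partial>lborel)
    = ennreal (g powr q) * (\<integral>\<^sup>+t\<in>{0<..}. ennreal (t powr (- q - 1)) * H t \<partial>lborel)"
proof -
  let ?f = "\<lambda>t. ennreal (t powr (- q - 1)) * H t * indicator {0<..} t"
  have pos: "g powr q * g * (g * t) powr (- q - 1) = t powr (- q - 1)" if "0 < t" for t
  proof -
    have "g powr q * g * (g * t) powr (- q - 1) = (g powr q * g powr 1 * g powr (- q - 1)) * t powr (- q - 1)"
      using that g by (simp add: powr_mult)
    also have "g powr q * g powr 1 * g powr (- q - 1) = 1"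
      using g by (simp only: powr_add[symmetric]) simp
    finally show ?thesis by simp
  qed
  have "ennreal (g powr q) * (\<integral>\<^sup>+t. ?f t \<partial>lborel) = ennreal (g powr q) * (ennreal \<bar>g\<bar> * (\<integral>\<^sup>+t. ?f (0 + g * t) \<partial>lborel))"
    using g by (subst nn_integral_real_affine[where c = g and t = 0]) auto
  also have "\<dots> = ennreal (g powr q * g) * (\<integral>\<^sup>+t. ?f (g * t) \<partial>lborel)"
    using g by (simp add: ennreal_mult mult.assoc)
  also have "\<dots> = (\<integral>\<^sup>+t. ennreal (g powr q * g) * ?f (g * t) \<partial>lborel)"
    by (rule nn_integral_cmult[symmetric]) measurable
  also have "\<dots> = (\<integral>\<^sup>+t\<in>{0<..}. ennreal (t powr (- q - 1)) * H (g * t) \<partial>lborel)"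
  proof (rule nn_integral_cong)
    fix t :: real
    show "ennreal (g powr q * g) * ?f (g * t) = ennreal (t powr (- q - 1)) * H (g * t) * indicator {0<..} t"
    proof (cases "0 < t")
      case True
      then have "ennreal (g powr q * g) * ennreal ((g * t) powr (- q - 1)) = ennreal (t powr (- q - 1))"
        using g pos[OF True] by (simp add: ennreal_mult[symmetric])
      then show ?thesis using True g by (simp add: mult.assoc[symmetric])
    qed (use g in \<open>simp add: zero_less_mult_iff\<close>)
  qed
  finally show ?thesis by simp
qed

text \<open>Only a lower bound with some positive constant is required. After scaling to g = 1 it is
  enough to integrate over t in (1, 2), where t^(-q-1) is at least 2^(-q-1). For G = top the
  right-hand side dominates the values for G = n^(1/q), hence all multiples of a positive
  constant.\<close>

lemma ennreal_powr_le_layers: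
  assumes q: "0 < q"
  shows "ennreal (2 powr (- q - 1)) * ennreal_powr G q
    \<le> (\<integral>\<^sup>+t\<in>{0<..}. ennreal (t powr (- q - 1)) * indicator {t. 1 < G * ennreal t} t \<partial>lborel)"
    (is "_ \<le> ?I G")
proof -
  have pos: "ennreal (2 powr (- q - 1) * g powr q) \<le> ?I (ennreal g)" if g: "0 < g" for g
  proof -
    let ?H = "indicator {1<..} :: real \<Rightarrow> ennreal"
    have "ennreal (2 powr (- q - 1)) = (\<integral>\<^sup>+t. ennreal (2 powr (- q - 1)) * indicator {1<..<2::real} t \<partial>lborel)"
      by (subst nn_integral_cmult_indicator) auto
    also have "\<dots> \<le> (\<integral>\<^sup>+t\<in>{0<..}. ennreal (t powr (- q - 1)) * ?H t \<partial>lborel)"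
      using q by (intro nn_integral_mono) (auto simp: indicator_def intro!: ennreal_leI powr_mono2')
    finally have "ennreal (g powr q) * ennreal (2 powr (- q - 1))
        \<le> ennreal (g powr q) * (\<integral>\<^sup>+t\<in>{0<..}. ennreal (t powr (- q - 1)) * ?H t \<partial>lborel)"
      by (rule mult_left_mono) simp
    also have "\<dots> = (\<integral>\<^sup>+t\<in>{0<..}. ennreal (t powr (- q - 1)) * ?H (g * t) \<partial>lborel)"
      using g by (intro nn_integral_powr_scale[symmetric]) auto
    also have "\<dots> = ?I (ennreal g)"
      using g by (intro nn_integral_cong) (auto simp: indicator_def ennreal_mult[symmetric] ennreal_less_iff
        simp flip: ennreal_1)
    finally show ?thesis by (simp add: ennreal_mult mult.commute)
  qed
  show ?thesis
  proof (cases G)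
    case (real g)
    then show ?thesis using pos[of g] by (cases "g = 0") (auto simp: ennreal_powr_ennreal ennreal_mult)
  next
    case top
    have "ennreal (2 powr (- q - 1) * real n) \<le> ?I top" for n :: nat
    proof (cases "n = 0")
      case False
      have "ennreal (2 powr (- q - 1) * (real n powr (1 / q)) powr q) \<le> ?I (ennreal (real n powr (1 / q)))"
        using False by (intro pos) simp
      also have "\<dots> \<le> ?I top"
      proof (intro nn_integral_mono mult_right_mono mult_left_mono)
        fix t :: real
        have "ennreal (real n powr (1 / q)) * ennreal t \<le> top * ennreal t" by (intro mult_right_mono) auto
        then show "indicator {t. 1 < ennreal (real n powr (1 / q)) * ennreal t} t
            \<le> (indicator {t. 1 < top * ennreal t} t :: ennreal)"
          by (auto simp: indicator_def)
      qed auto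
      finally show ?thesis using q by (simp add: powr_powr)
    qed simp
    then have "?I top = top"
    proof (rule_tac ccontr)
      assume *: "\<And>n::nat. ennreal (2 powr (- q - 1) * real n) \<le> ?I top" "?I top \<noteq> top"
      then obtain i where i: "?I top = ennreal i" "0 \<le> i" by (cases "?I top") auto
      obtain n :: nat where "i < real n * 2 powr (- q - 1)"
        using ex_less_of_nat_mult[of "2 powr (- q - 1)" i] by auto
      with *(1)[of n] show False unfolding i(1) using i(2) by (simp add: mult.commute)
    qed
    with top show ?thesis by simp
  qed
qed

text \<open>The pointwise layer bound is integrated and the order of integration exchanged. The
  condition \<open>1 < G x * ennreal t\<close> is the level set of G above 1/t, written so that
  infinite values of G cause no trouble.\<close>

lemma (in sigma_finite_measure) layer_cake_le:
  fixes G :: "'a \<Rightarrow> ennreal"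
  assumes q: "0 < q" and G[measurable]: "G \<in> borel_measurable M" and S[measurable]: "S \<in> sets M"
  shows "ennreal (2 powr (- q - 1)) * (\<integral>\<^sup>+x\<in>S. ennreal_powr (G x) q \<partial>M)
    \<le> (\<integral>\<^sup>+t\<in>{0<..}. ennreal (t powr (- q - 1)) * emeasure M {x\<in>S. 1 < G x * ennreal t} \<partial>lborel)"
proof -
  interpret pair_sigma_finite M "lborel :: real measure" ..
  have S': "x \<in> space M" if "x \<in> S" for x using sets.sets_into_space[OF S] that by blast
  have "ennreal (2 powr (- q - 1)) * (\<integral>\<^sup>+x\<in>S. ennreal_powr (G x) q \<partial>M)
     = (\<integral>\<^sup>+x. ennreal (2 powr (- q - 1)) * (ennreal_powr (G x) q * indicator S x) \<partial>M)"
    by (rule nn_integral_cmult[symmetric]) measurable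
  also have "\<dots> \<le> (\<integral>\<^sup>+x. (\<integral>\<^sup>+t. ennreal (t powr (- q - 1)) * indicator {t. 1 < G x * ennreal t} t
      * indicator {0<..} t * indicator S x \<partial>lborel) \<partial>M)"
  proof (rule nn_integral_mono)
    fix x
    show "ennreal (2 powr (- q - 1)) * (ennreal_powr (G x) q * indicator S x)
      \<le> (\<integral>\<^sup>+t. ennreal (t powr (- q - 1)) * indicator {t. 1 < G x * ennreal t} t
      * indicator {0<..} t * indicator S x \<partial>lborel)"
      using ennreal_powr_le_layers[OF q, of "G x"] by (cases "x \<in> S") auto
  qed
  also have "\<dots> = (\<integral>\<^sup>+t. (\<integral>\<^sup>+x. ennreal (t powr (- q - 1)) * indicator {t. 1 < G x * ennreal t} t
      * indicator {0<..} t * indicator S x \<partial>M) \<partial>lborel)"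
    by (rule Fubini'[symmetric]) measurable
  also have "\<dots> = (\<integral>\<^sup>+t\<in>{0<..}. ennreal (t powr (- q - 1)) * emeasure M {x\<in>S. 1 < G x * ennreal t} \<partial>lborel)"
  proof (rule nn_integral_cong)
    fix t :: real
    have [measurable]: "{x\<in>S. 1 < G x * ennreal t} \<in> sets M"
    proof -
      have "{x\<in>S. 1 < G x * ennreal t} = S \<inter> {x\<in>space M. 1 < G x * ennreal t}" using S' by auto
      also have "\<dots> \<in> sets M" by measurable
      finally show ?thesis .
    qed
    have "(\<integral>\<^sup>+x. ennreal (t powr (- q - 1)) * indicator {t. 1 < G x * ennreal t} t
        * indicator {0<..} t * indicator S x \<partial>M)
      = (\<integral>\<^sup>+x. (ennreal (t powr (- q - 1)) * indicator {0<..} t) * indicator {x\<in>S. 1 < G x * ennreal t} x \<partial>M)"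
      by (intro nn_integral_cong) (auto simp: indicator_def)
    also have "\<dots> = (ennreal (t powr (- q - 1)) * indicator {0<..} t) * emeasure M {x\<in>S. 1 < G x * ennreal t}"
      by (rule nn_integral_cmult_indicator) measurable
    finally show "(\<integral>\<^sup>+x. ennreal (t powr (- q - 1)) * indicator {t. 1 < G x * ennreal t} t
        * indicator {0<..} t * indicator S x \<partial>M)
      = ennreal (t powr (- q - 1)) * emeasure M {x\<in>S. 1 < G x * ennreal t} * indicator {0<..} t"
      by (simp add: mult_ac)
  qed
  finally show ?thesis .
qed

section \<open>Maximal functions\<close>

lemma luxemburg_cong:
  assumes "\<And>x. x \<in> B \<Longrightarrow> norm (f x) = norm (g x)"
  shows "luxemburg \<Psi> B f = luxemburg \<Psi> B g"
proof -
  have "average B (\<lambda>x. ennreal (\<Psi> (norm (f x) / l))) = average B (\<lambda>x. ennreal (\<Psi> (norm (g x) / l)))" for l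
    unfolding average_def using assms
    by (intro arg_cong2[where f = "(/)"] nn_integral_cong refl) (auto simp: indicator_def)
  then show ?thesis by (simp add: luxemburg_def)
qed

lemma measure_lebesgue_ball_pos: "0 < r \<Longrightarrow> 0 < measure lebesgue (ball y r)"
  for y :: "'a::euclidean_space"
  by simp

lemma measure_lebesgue_ball_mono:
  fixes y z :: "'a::euclidean_space"
  assumes "0 \<le> r" "r \<le> s"
  shows "measure lebesgue (ball y r) \<le> measure lebesgue (ball z s)"
  using assms by (simp add: content_ball mult_left_mono power_mono)

lemma frac_maximal_upper:
  fixes x y :: "'a::euclidean_space"
  assumes "0 < r" "x \<in> ball y r"
  shows "ennreal (measure lebesgue (ball y r) powr (\<beta> / DIM('a))) * luxemburg \<Psi> (ball y r) f
    \<le> frac_maximal \<beta> \<Psi> f x"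
  unfolding frac_maximal_def using assms by (intro SUP_upper) auto

lemma frac_maximal_least:
  fixes x :: "'a::euclidean_space"
  assumes "\<And>y r. 0 < r \<Longrightarrow> x \<in> ball y r \<Longrightarrow>
    ennreal (measure lebesgue (ball y r) powr (\<beta> / DIM('a))) * luxemburg \<Psi> (ball y r) f \<le> c"
  shows "frac_maximal \<beta> \<Psi> f x \<le> c"
  unfolding frac_maximal_def using assms by (intro SUP_least) blast

lemma luxemburg_le_maximal:
  fixes x y :: "'a::euclidean_space"
  assumes "0 < r" "x \<in> ball y r"
  shows "luxemburg \<Psi> (ball y r) f \<le> frac_maximal 0 \<Psi> f x"
  using frac_maximal_upper[OF assms, of 0 \<Psi> f] measure_lebesgue_ball_pos[OF assms(1), of y] by simp

text \<open>The supremum runs over all balls containing x, so a ball that witnesses the inequality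
  at x witnesses it at each of its points. Hence the maximal function is lower semicontinuous, and
  Borel measurable, for any f whatever.\<close>

lemma open_frac_maximal_greater: "open {x. c < frac_maximal \<beta> \<Psi> f x}"
  for f :: "'a::euclidean_space \<Rightarrow> 'b::real_normed_vector"
proof (rule openI)
  fix x assume "x \<in> {x. c < frac_maximal \<beta> \<Psi> f x}"
  then obtain y r where yr: "0 < r" "x \<in> ball y r"
      "c < ennreal (measure lebesgue (ball y r) powr (\<beta> / DIM('a))) * luxemburg \<Psi> (ball y r) f"
    unfolding frac_maximal_def mem_Collect_eq less_SUP_iff by auto
  have "ball y r \<subseteq> {x. c < frac_maximal \<beta> \<Psi> f x}"
    using less_le_trans[OF yr(3) frac_maximal_upper[OF yr(1)]] by auto
  moreover obtain e where "0 < e" "ball x e \<subseteq> ball y r"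
    using open_ball yr(2) openE by blast
  ultimately show "\<exists>e>0. ball x e \<subseteq> {x. c < frac_maximal \<beta> \<Psi> f x}" by blast
qed

lemma borel_measurable_frac_maximal: "frac_maximal \<beta> \<Psi> f \<in> borel_measurable borel"
  by (rule borel_measurableI_greater) (simp add: borel_open open_frac_maximal_greater)

lemma borel_measurable_frac_maximal_lebesgue [measurable]:
  "frac_maximal \<beta> \<Psi> f \<in> borel_measurable lebesgue"
  using borel_measurable_frac_maximal[of \<beta> \<Psi> f] by (simp add: measurable_completion)

lemma frac_maximal_pos:
  fixes f :: "'a::euclidean_space \<Rightarrow> 'b::{real_normed_vector,second_countable_topology}"
  assumes "young_function \<Psi>" "f \<in> borel_measurable lebesgue" "AE x in lebesgue. f x \<noteq> 0"
  shows "0 < frac_maximal \<beta> \<Psi> f x"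
proof -
  have "0 < ennreal (measure lebesgue (ball x 1) powr (\<beta> / DIM('a))) * luxemburg \<Psi> (ball x 1) f"
    using measure_lebesgue_ball_pos[of 1 x] luxemburg_pos[OF assms, of 1 x]
    by (simp add: ennreal_zero_less_mult_iff)
  also have "\<dots> \<le> frac_maximal \<beta> \<Psi> f x" by (rule frac_maximal_upper) auto
  finally show ?thesis .
qed

text \<open>The whole power of the measure of the ball is given to the \<F> factor, leaving for \<E>
  a maximal function of order 0, to which the B class applies. Finiteness of the \<F> maximal
  function at x makes each average over a ball through x finite.\<close>

lemma frac_maximal_hoelder:
  fixes h :: "'a::euclidean_space \<Rightarrow> 'b::real_normed_vector" and a b :: "'a \<Rightarrow> real"
  assumes \<phi>: "young_function \<phi>" and \<E>: "young_function \<E>" and \<F>: "young_function \<F>"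
    and inv: "\<forall>t\<ge>0. young_inverse \<E> t * young_inverse \<F> t \<le> young_inverse \<phi> t"
    and a: "a \<in> borel_measurable lebesgue" and b: "b \<in> borel_measurable lebesgue"
    and ab: "AE x in lebesgue. norm (h x) = norm (a x) * norm (b x)"
    and pos: "AE x in lebesgue. b x \<noteq> 0"
    and fin: "frac_maximal \<alpha> \<F> b x < \<infinity>"
  shows "frac_maximal \<alpha> \<phi> h x \<le> 4 * frac_maximal 0 \<E> a x * frac_maximal \<alpha> \<F> b x"
proof (rule frac_maximal_least)
  fix y :: 'a and r :: real assume r: "0 < r" "x \<in> ball y r"
  let ?B = "ball y r" and ?m = "ennreal (measure lebesgue (ball y r) powr (\<alpha> / DIM('a)))"
  have m: "0 < ?m" using measure_lebesgue_ball_pos[OF r(1), of y] by simp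
  have "?m * luxemburg \<F> ?B b < \<infinity>"
    using le_less_trans[OF frac_maximal_upper[OF r] fin] .
  then have "luxemburg \<F> ?B b < \<infinity>"
    using m by (auto simp: ennreal_mult_less_top top.not_eq_extremum ennreal_mult_eq_top_iff less_top)
  then have "luxemburg \<phi> ?B h \<le> 4 * luxemburg \<E> ?B a * luxemburg \<F> ?B b"
    by (intro luxemburg_hoelder[OF \<phi> \<E> \<F> inv a b ab r(1)] luxemburg_pos[OF \<F> b pos r(1)])
  then have "?m * luxemburg \<phi> ?B h \<le> ?m * (4 * luxemburg \<E> ?B a * luxemburg \<F> ?B b)"
    by (rule mult_left_mono) simp
  also have "\<dots> = 4 * luxemburg \<E> ?B a * (?m * luxemburg \<F> ?B b)" by (simp only: mult_ac)
  also have "\<dots> \<le> 4 * frac_maximal 0 \<E> a x * frac_maximal \<alpha> \<F> b x"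
    by (intro mult_mono luxemburg_le_maximal[OF r] frac_maximal_upper[OF r]) auto
  finally show "?m * luxemburg \<phi> ?B h \<le> 4 * frac_maximal 0 \<E> a x * frac_maximal \<alpha> \<F> b x" .
qed

text \<open>If l is admissible for u and \<open>t \<mapsto> \<F> (t powr (1 / p))\<close>, then
  l^(1/p) is admissible for u^(1/p) and \<F>, because the arguments of \<F> coincide. The power of
  the measure of the ball passes from exponent \<alpha>/n to \<alpha> p/n in the same way. No
  property of \<F> enters.\<close>

lemma frac_maximal_powr_le:
  fixes u :: "'a::euclidean_space \<Rightarrow> real"
  assumes p: "0 < p" and u: "\<And>x. 0 \<le> u x"
  shows "ennreal_powr (frac_maximal \<alpha> \<F> (\<lambda>x. u x powr (1 / p)) x) p
    \<le> frac_maximal (\<alpha> * p) (\<lambda>t. \<F> (t powr (1 / p))) u x"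
  unfolding ennreal_powr_le_iff[OF p]
proof (rule frac_maximal_least)
  fix y :: 'a and r :: real assume r: "0 < r" "x \<in> ball y r"
  let ?B = "ball y r" and ?\<D> = "\<lambda>t. \<F> (t powr (1 / p))" and ?U = "\<lambda>x. u x powr (1 / p)"
  let ?v = "measure lebesgue ?B"
  have "ennreal_powr (luxemburg \<F> ?B ?U) p \<le> luxemburg ?\<D> ?B u"
    unfolding luxemburg_def[of ?\<D>]
  proof (rule Inf_greatest)
    fix e assume "e \<in> {ennreal l |l. 0 < l \<and> average ?B (\<lambda>x. ennreal (?\<D> (norm (u x) / l))) \<le> 1}"
    then obtain l where l: "e = ennreal l" "0 < l" "average ?B (\<lambda>x. ennreal (?\<D> (norm (u x) / l))) \<le> 1"
      by auto
    have "norm (?U x) / l powr (1 / p) = (norm (u x) / l) powr (1 / p)" for x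
      using u[of x] l(2) by (simp add: powr_divide)
    then have "luxemburg \<F> ?B ?U \<le> ennreal (l powr (1 / p))"
      unfolding luxemburg_def using l by (intro Inf_lower) auto
    then show "ennreal_powr (luxemburg \<F> ?B ?U) p \<le> e"
      unfolding ennreal_powr_le_iff[OF p] l(1) using l(2) by (simp add: ennreal_powr_ennreal)
  qed
  moreover have "ennreal_powr (ennreal (?v powr (\<alpha> / DIM('a)))) p = ennreal (?v powr (\<alpha> * p / DIM('a)))"
    by (simp add: ennreal_powr_ennreal powr_powr)
  ultimately have "ennreal_powr (ennreal (?v powr (\<alpha> / DIM('a))) * luxemburg \<F> ?B ?U) p
      \<le> ennreal (?v powr (\<alpha> * p / DIM('a))) * luxemburg ?\<D> ?B u"
    by (simp add: ennreal_powr_mult mult_left_mono)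
  also have "\<dots> \<le> frac_maximal (\<alpha> * p) ?\<D> u x" by (rule frac_maximal_upper[OF r])
  finally show "ennreal (?v powr (\<alpha> / DIM('a))) * luxemburg \<F> ?B ?U
      \<le> ennreal_powr (frac_maximal (\<alpha> * p) ?\<D> u x) (1 / p)"
    unfolding ennreal_powr_le_iff[OF p] .
qed

section \<open>Strong type bound under the B condition\<close>

lemma maximal_greaterE:
  fixes x :: "'a::euclidean_space"
  assumes "1 < frac_maximal 0 \<Psi> f x * ennreal t" and t: "0 < t"
  obtains y r where "0 < r" "x \<in> ball y r"
    "emeasure lebesgue (ball y r) < (\<integral>\<^sup>+z\<in>ball y r. ennreal (\<Psi> (norm (f z) * t)) \<partial>lebesgue)"
proof -
  have "ennreal (1 / t) < frac_maximal 0 \<Psi> f x"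
  proof (rule ccontr)
    assume "\<not> ennreal (1 / t) < frac_maximal 0 \<Psi> f x"
    then have "frac_maximal 0 \<Psi> f x * ennreal t \<le> ennreal (1 / t) * ennreal t"
      by (intro mult_right_mono) auto
    also have "\<dots> = 1" using t by (simp add: ennreal_mult[symmetric])
    finally show False using assms(1) by simp
  qed
  then obtain y r where yr: "0 < r" "x \<in> ball y r"
      "ennreal (1 / t) < ennreal (measure lebesgue (ball y r) powr (0 / DIM('a))) * luxemburg \<Psi> (ball y r) f"
    unfolding frac_maximal_def less_SUP_iff by auto
  then have less: "ennreal (1 / t) < luxemburg \<Psi> (ball y r) f"
    using measure_lebesgue_ball_pos[OF yr(1), of y] by simp
  have "\<not> (\<integral>\<^sup>+z\<in>ball y r. ennreal (\<Psi> (norm (f z) / (1 / t))) \<partial>lebesgue) \<le> emeasure lebesgue (ball y r)"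
    using luxemburg_le[where l = "1 / t" and r = r and y = y and \<Psi> = \<Psi> and f = f] less t yr(1) by auto
  then show ?thesis using that[OF yr(1,2)] by simp
qed

text \<open>The sufficiency half of Perez's B_p theorem. In the weak type estimate the small values
  of |g| t are absorbed, which leaves a modular H vanishing near 0; integrating it against t^(-q-1)
  dt gives |g|^q times a constant that is finite by the B condition.\<close>

lemma maximal_strong_type:
  assumes \<E>: "young_function \<E>" and B: "B_class q \<E>" and q: "1 < q"
  shows "\<exists>C>0. \<forall>g::'a::euclidean_space \<Rightarrow> real. g \<in> borel_measurable lebesgue \<longrightarrow>
    (\<integral>\<^sup>+x. ennreal_powr (frac_maximal 0 \<E> g x) q \<partial>lebesgue)
      \<le> ennreal C * (\<integral>\<^sup>+x. ennreal (\<bar>g x\<bar> powr q) \<partial>lebesgue)"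
proof -
  \<comment> \<open>Chosen so that \<E> c \<le> 1/2: then the values |g| t \<le> c contribute at
    most half the measure of a ball to its modular. The summand 1 covers the case \<E> 1 = 0 and
    gives c \<le> 1.\<close>
  define c where "c = 1 / (2 * (1 + \<E> 1))"
  have E1: "0 \<le> \<E> 1" by (rule young_nonneg[OF \<E>]) simp
  then have c: "0 < c" "c \<le> 1" by (auto simp: c_def field_simps)
  have "\<E> (c * 1) \<le> c * \<E> 1" using c by (intro young_scale[OF \<E>]) auto
  also have "\<dots> \<le> 1 / 2" using E1 by (simp add: c_def field_simps)
  finally have Ec: "\<E> c \<le> 1 / 2" by simp
  define H where "H s = (if c < s then ennreal (\<E> s) else 0)" for s
  have H[measurable]: "H \<in> borel_measurable borel"
  proof -
    have [measurable]: "(\<lambda>s. \<E> (max 0 s)) \<in> borel_measurable borel"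
      by (rule young_measurable[OF \<E>]) auto
    have "(\<lambda>s. if c < s then ennreal (\<E> (max 0 s)) else 0) \<in> borel_measurable borel" by measurable
    also have "(\<lambda>s. if c < s then ennreal (\<E> (max 0 s)) else 0) = H"
      using c by (auto simp: H_def fun_eq_iff max_def)
    finally show ?thesis .
  qed
  \<comment> \<open>Below c the integrand is 0, between c and 1 it is bounded, and from 1 on it is
    the integrand of \<open>B_class\<close>. The cut at c is what makes the integral converge at
    0.\<close>
  define K where "K = (\<integral>\<^sup>+s\<in>{0<..}. ennreal (s powr (- q - 1)) * H s \<partial>lborel)"
  have "K \<le> (\<integral>\<^sup>+s. ennreal (c powr (- q - 1) * \<E> 1) * indicator {0..1} s
      + ennreal (\<E> s / s powr q / s) * indicator {1..} s \<partial>lborel)"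
    unfolding K_def
  proof (rule nn_integral_mono)
    fix s :: real
    consider "s \<le> c" | "c < s" "s < 1" | "1 \<le> s" using c by linarith
    then show "ennreal (s powr (- q - 1)) * H s * indicator {0<..} s \<le>
       ennreal (c powr (- q - 1) * \<E> 1) * indicator {0..1} s + ennreal (\<E> s / s powr q / s) * indicator {1..} s"
    proof cases
      case 2
      then have "s powr (- q - 1) * \<E> s \<le> c powr (- q - 1) * \<E> 1"
        using c q by (intro mult_mono powr_mono2' young_mono[OF \<E>] young_nonneg[OF \<E>]) auto
      then show ?thesis using 2 c
        by (simp add: H_def ennreal_mult[symmetric] young_nonneg[OF \<E>] ennreal_leI)
    next
      case 3
      have "s powr (- q - 1) * \<E> s = \<E> s / s powr q / s"
        using 3 by (simp add: powr_diff powr_minus divide_simps)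
      then show ?thesis using 3
        by (auto simp: H_def ennreal_mult[symmetric] young_nonneg[OF \<E>] indicator_def)
    qed (simp add: H_def)
  qed
  also have "\<dots> = ennreal (c powr (- q - 1) * \<E> 1) * emeasure lborel {0..1::real}
      + (\<integral>\<^sup>+s\<in>{1..}. ennreal (\<E> s / s powr q / s) \<partial>lborel)"
  proof (subst nn_integral_add)
    have [measurable]: "(\<lambda>s. \<E> (max 0 s)) \<in> borel_measurable borel"
      by (rule young_measurable[OF \<E>]) auto
    have "(\<lambda>s. ennreal (\<E> (max 0 s) / s powr q / s) * indicator {1..} s) \<in> borel_measurable lborel"
      by measurable
    also have "(\<lambda>s. ennreal (\<E> (max 0 s) / s powr q / s) * indicator {1..} s)
        = (\<lambda>s. ennreal (\<E> s / s powr q / s) * indicator {1..} s)"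
      by (auto simp: fun_eq_iff indicator_def max_def)
    finally show "(\<lambda>s. ennreal (\<E> s / s powr q / s) * indicator {1..} s) \<in> borel_measurable lborel" .
  qed (simp_all add: nn_integral_cmult_indicator)
  also have "\<dots> < \<infinity>"
    using B by (simp add: B_class_def)
  finally have "K < \<infinity>" .
  then obtain k where k: "K = ennreal k" "0 \<le> k" by (cases K) auto
  let ?\<kappa> = "2 powr (- q - 1)" and ?d = "5 ^ DIM('a) * 2 :: real"
  interpret sigma_finite_measure "lebesgue :: 'a measure" by (rule sigma_finite_lebesgue)
  interpret P: pair_sigma_finite "lebesgue :: 'a measure" "lborel :: real measure" ..
  show ?thesis
  proof (intro exI[of _ "?d * (k + 1) / ?\<kappa>"] conjI allI impI)
    show "0 < ?d * (k + 1) / ?\<kappa>" using k(2) by simp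
    fix g :: "'a \<Rightarrow> real" assume g[measurable]: "g \<in> borel_measurable lebesgue"
    let ?M = "frac_maximal 0 \<E> g"
    have weak: "emeasure lebesgue {x\<in>UNIV. 1 < ?M x * ennreal t}
        \<le> ennreal (5 ^ DIM('a)) * (\<integral>\<^sup>+x. 2 * H (\<bar>g x\<bar> * t) \<partial>lebesgue)" if t: "0 < t" for t
    proof (rule emeasure_le_of_ball_cover)
      have Hm: "(\<lambda>z. H (\<bar>g z\<bar> * t)) \<in> borel_measurable lebesgue" by measurable
      note [intro!] = borel_measurable_times_ennreal borel_measurable_indicator Hm
      show "(\<lambda>x. 2 * H (\<bar>g x\<bar> * t)) \<in> borel_measurable lebesgue" by measurable
      fix x assume "x \<in> {x \<in> UNIV. 1 < ?M x * ennreal t}"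
      then have "1 < ?M x * ennreal t" by simp
      from maximal_greaterE[OF this t] obtain y r where r: "0 < r" "x \<in> ball y r"
        and less: "emeasure lebesgue (ball y r) < (\<integral>\<^sup>+z\<in>ball y r. ennreal (\<E> (norm (g z) * t)) \<partial>lebesgue)" .
      note less
      also have "(\<integral>\<^sup>+z\<in>ball y r. ennreal (\<E> (norm (g z) * t)) \<partial>lebesgue)
         \<le> (\<integral>\<^sup>+z. ennreal (1 / 2) * indicator (ball y r) z + H (\<bar>g z\<bar> * t) * indicator (ball y r) z \<partial>lebesgue)"
      proof (rule nn_integral_mono)
        fix z
        have "\<E> (norm (g z) * t) \<le> 1 / 2" if "norm (g z) * t \<le> c"
          using order_trans[OF young_mono[OF \<E> _ that] Ec] t by simp
        then have "ennreal (\<E> (norm (g z) * t)) \<le> ennreal (1 / 2) + H (\<bar>g z\<bar> * t)"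
          by (cases "c < \<bar>g z\<bar> * t") (auto simp: H_def simp del: ennreal_half intro!: ennreal_leI)
        then show "ennreal (\<E> (norm (g z) * t)) * indicator (ball y r) z
            \<le> ennreal (1 / 2) * indicator (ball y r) z + H (\<bar>g z\<bar> * t) * indicator (ball y r) z"
          by (cases "z \<in> ball y r") simp_all
      qed
      also have "\<dots> = ennreal (1 / 2) * emeasure lebesgue (ball y r)
          + (\<integral>\<^sup>+z. H (\<bar>g z\<bar> * t) * indicator (ball y r) z \<partial>lebesgue)" (is "_ = _ + ?J")
        by (subst nn_integral_add) (auto simp: nn_integral_cmult_indicator)
      finally have le: "emeasure lebesgue (ball y r) < ennreal (1 / 2) * emeasure lebesgue (ball y r) + ?J" .
      \<comment> \<open>Half of the measure of the ball is absorbed on the left, which is legitimate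
        since that measure is finite.\<close>
      have "emeasure lebesgue (ball y r) \<le> 2 * ?J"
      proof (cases ?J)
        case (real j)
        obtain b where b: "emeasure lebesgue (ball y r) = ennreal b" "0 \<le> b"
          using emeasure_lebesgue_ball_finite[of y r] by (cases "emeasure lebesgue (ball y r)") auto
        have "ennreal b < ennreal (1 / 2 * b + j)"
          using le unfolding real(2) b(1) using real(1) b(2)
          by (subst ennreal_plus, simp, simp, subst ennreal_mult) (simp_all del: ennreal_half)
        then have "b \<le> 2 * j" using b by (simp add: ennreal_less_iff)
        then have "ennreal b \<le> ennreal (2 * j)" by (rule ennreal_leI)
        then show ?thesis using real b by (simp add: ennreal_mult)
      qed (simp add: ennreal_mult_top)
      also have "2 * ?J = (\<integral>\<^sup>+z\<in>ball y r. 2 * H (\<bar>g z\<bar> * t) \<partial>lebesgue)"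
        by (subst nn_integral_cmult[symmetric]) (auto simp: mult.assoc)
      finally show "\<exists>y r. 0 < r \<and> x \<in> ball y r \<and>
          emeasure lebesgue (ball y r) \<le> (\<integral>\<^sup>+z\<in>ball y r. 2 * H (\<bar>g z\<bar> * t) \<partial>lebesgue)"
        using r by blast
    qed
    have "ennreal ?\<kappa> * (\<integral>\<^sup>+x. ennreal_powr (?M x) q \<partial>lebesgue)
        \<le> (\<integral>\<^sup>+t\<in>{0<..}. ennreal (t powr (- q - 1)) * emeasure lebesgue {x\<in>UNIV. 1 < ?M x * ennreal t} \<partial>lborel)"
      using layer_cake_le[of q ?M UNIV] q by simp
    also have "\<dots> \<le> (\<integral>\<^sup>+t. (\<integral>\<^sup>+x. ennreal ?d * (ennreal (t powr (- q - 1)) * H (\<bar>g x\<bar> * t) * indicator {0<..} t) \<partial>lebesgue) \<partial>lborel)"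
    proof (rule nn_integral_mono)
      fix t :: real
      show "ennreal (t powr (- q - 1)) * emeasure lebesgue {x\<in>UNIV. 1 < ?M x * ennreal t} * indicator {0<..} t
        \<le> (\<integral>\<^sup>+x. ennreal ?d * (ennreal (t powr (- q - 1)) * H (\<bar>g x\<bar> * t) * indicator {0<..} t) \<partial>lebesgue)"
      proof (cases "0 < t")
        case True
        have "ennreal (t powr (- q - 1)) * emeasure lebesgue {x\<in>UNIV. 1 < ?M x * ennreal t}
            \<le> ennreal (t powr (- q - 1)) * (ennreal (5 ^ DIM('a)) * (\<integral>\<^sup>+x. 2 * H (\<bar>g x\<bar> * t) \<partial>lebesgue))"
          by (intro mult_left_mono weak True) simp
        also have "\<dots> = (\<integral>\<^sup>+x. ennreal (t powr (- q - 1)) * (ennreal (5 ^ DIM('a)) * (2 * H (\<bar>g x\<bar> * t))) \<partial>lebesgue)"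
          by (subst nn_integral_cmult[symmetric], measurable)+
        also have "\<dots> = (\<integral>\<^sup>+x. ennreal ?d * (ennreal (t powr (- q - 1)) * H (\<bar>g x\<bar> * t) * indicator {0<..} t) \<partial>lebesgue)"
          using True by (intro nn_integral_cong) (simp add: ennreal_mult mult_ac)
        finally show ?thesis using True by simp
      qed simp
    qed
    \<comment> \<open>After the exchange of integrals the inner one depends on x only through the
      dilation by |g x|, so the scaling lemma evaluates it as |g x|^q times K. Where g x = 0 both
      sides are 0, since H 0 = 0.\<close>
    also have "\<dots> = (\<integral>\<^sup>+x. (\<integral>\<^sup>+t. ennreal ?d * (ennreal (t powr (- q - 1)) * H (\<bar>g x\<bar> * t) * indicator {0<..} t) \<partial>lborel) \<partial>lebesgue)"
      by (rule P.Fubini') measurable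
    also have "\<dots> = (\<integral>\<^sup>+x. ennreal (?d * k) * ennreal (\<bar>g x\<bar> powr q) \<partial>lebesgue)"
    proof (rule nn_integral_cong)
      fix x
      have "(\<integral>\<^sup>+t. ennreal ?d * (ennreal (t powr (- q - 1)) * H (\<bar>g x\<bar> * t) * indicator {0<..} t) \<partial>lborel)
          = ennreal ?d * (\<integral>\<^sup>+t\<in>{0<..}. ennreal (t powr (- q - 1)) * H (\<bar>g x\<bar> * t) \<partial>lborel)"
        by (rule nn_integral_cmult) measurable
      also have "(\<integral>\<^sup>+t\<in>{0<..}. ennreal (t powr (- q - 1)) * H (\<bar>g x\<bar> * t) \<partial>lborel) = ennreal (\<bar>g x\<bar> powr q) * ennreal k"
      proof (cases "g x = 0")
        case True
        then show ?thesis using c by (simp add: H_def)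
      next
        case False
        then show ?thesis unfolding k(1)[symmetric] K_def
          by (intro nn_integral_powr_scale H) simp
      qed
      finally show "(\<integral>\<^sup>+t. ennreal ?d * (ennreal (t powr (- q - 1)) * H (\<bar>g x\<bar> * t) * indicator {0<..} t) \<partial>lborel)
          = ennreal (?d * k) * ennreal (\<bar>g x\<bar> powr q)"
        using k(2) by (simp add: ennreal_mult mult_ac)
    qed
    also have "\<dots> = ennreal (?d * k) * (\<integral>\<^sup>+x. ennreal (\<bar>g x\<bar> powr q) \<partial>lebesgue)"
      by (rule nn_integral_cmult) measurable
    also have "\<dots> \<le> ennreal (?\<kappa> * (?d * (k + 1) / ?\<kappa>)) * (\<integral>\<^sup>+x. ennreal (\<bar>g x\<bar> powr q) \<partial>lebesgue)"
      by (intro mult_right_mono ennreal_leI) auto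
    also have "\<dots> = ennreal ?\<kappa> * (ennreal (?d * (k + 1) / ?\<kappa>) * (\<integral>\<^sup>+x. ennreal (\<bar>g x\<bar> powr q) \<partial>lebesgue))"
      by (subst ennreal_mult') (simp_all add: mult.assoc)
    finally show "(\<integral>\<^sup>+x. ennreal_powr (?M x) q \<partial>lebesgue)
        \<le> ennreal (?d * (k + 1) / ?\<kappa>) * (\<integral>\<^sup>+x. ennreal (\<bar>g x\<bar> powr q) \<partial>lebesgue)"
      by (subst (asm) ennreal_mult_le_mult_iff) (simp_all add: ennreal_eq_0_iff)
  qed
qed

section \<open>Muckenhoupt weights from maximal functions\<close>

text \<open>The \<open>A\<^sub>1\<close> condition with pointwise bounds, for functions that may take the value \<open>\<infinity>\<close>.\<close>

definition a1_bound :: "real \<Rightarrow> ('a::euclidean_space \<Rightarrow> ennreal) \<Rightarrow> bool" where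
  "a1_bound C G \<longleftrightarrow> (\<forall>z r y. 0 < r \<longrightarrow> y \<in> ball z r \<longrightarrow>
     (\<integral>\<^sup>+x\<in>ball z r. G x \<partial>lebesgue) \<le> ennreal C * G y * emeasure lebesgue (ball z r))"

text \<open>Kolmogorov's inequality in Orlicz form, the local half of the Coifman-Rochberg argument.
  The weak type estimate decays only to first order, so it can be integrated for powers below 1.
  Positivity of the average excludes the scale 0.\<close>

lemma maximal_half_power_bound:
  assumes F: "young_function \<F>"
  shows "\<exists>C>0. \<forall>(U::'a::euclidean_space \<Rightarrow> real) z r.
    U \<in> borel_measurable lebesgue \<longrightarrow> 0 < r \<longrightarrow> 0 < luxemburg \<F> (ball z (3 * r)) U \<longrightarrow>
    (\<integral>\<^sup>+x\<in>ball z r. ennreal_powr (frac_maximal 0 \<F> (\<lambda>x. U x * indicator (ball z (3 * r)) x) x) (1 / 2) \<partial>lebesgue)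
      \<le> ennreal C * ennreal_powr (luxemburg \<F> (ball z (3 * r)) U) (1 / 2) * emeasure lebesgue (ball z r)"
proof -
  let ?d = "15 ^ DIM('a) :: real"
  \<comment> \<open>H bounds the relative measure in the ball of the level set at s = l t. For s
    \<le> 1 convexity gives the linear bound, with 15^n = 5^n 3^n from the covering lemma and from
    the ratio of the measures of the two balls; for s > 1 the trivial bound 1 is used. Since 1/2 <
    1, s^(-3/2) H(s) is integrable at 0 as well as at infinity.\<close>
  define H where "H s = (if s \<le> 1 then ennreal (?d * s) else 1)" for s
  have H[measurable]: "H \<in> borel_measurable borel" unfolding H_def by measurable
  define K where "K = (\<integral>\<^sup>+s\<in>{0<..}. ennreal (s powr (- (1 / 2) - 1)) * H s \<partial>lborel)"
  have i1: "(\<integral>\<^sup>+s. ennreal (?d * s powr (- 1 / 2)) * indicator {0..1} s \<partial>lborel) < \<infinity>"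
  proof -
    have "((\<lambda>x. ?d * x powr (- 1 / 2)) has_integral ?d * (1 powr (- 1 / 2 + 1) / (- 1 / 2 + 1))) {0..1::real}"
      by (intro has_integral_mult_right has_integral_powr_from_0) auto
    from nn_integral_has_integral_lebesgue'[OF _ this] show ?thesis by simp
  qed
  have i2: "(\<integral>\<^sup>+s. ennreal (s powr (- 3 / 2)) * indicator {1..} s \<partial>lborel) < \<infinity>"
  proof -
    have "((\<lambda>x. x powr (- 3 / 2)) has_integral - (1 powr (- 3 / 2 + 1)) / (- 3 / 2 + 1)) {1::real..}"
      by (intro has_integral_powr_to_inf) auto
    from nn_integral_has_integral_lebesgue'[OF _ this] show ?thesis by simp
  qed
  have "K \<le> (\<integral>\<^sup>+s. ennreal (?d * s powr (- 1 / 2)) * indicator {0..1} s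
      + ennreal (s powr (- 3 / 2)) * indicator {1..} s \<partial>lborel)"
    unfolding K_def
  proof (rule nn_integral_mono)
    fix s :: real
    consider "s \<le> 0" | "0 < s" "s \<le> 1" | "1 < s" by linarith
    then show "ennreal (s powr (- (1 / 2) - 1)) * H s * indicator {0<..} s \<le>
       ennreal (?d * s powr (- 1 / 2)) * indicator {0..1} s + ennreal (s powr (- 3 / 2)) * indicator {1..} s"
    proof cases
      case 2
      have "s powr (- (1 / 2) - 1) * (?d * s) = ?d * (s powr (- (1 / 2) - 1) * s powr 1)"
        using 2 by simp
      also have "s powr (- (1 / 2) - 1) * s powr 1 = s powr (- 1 / 2)"
        unfolding powr_add[symmetric] by simp
      finally have "ennreal (s powr (- (1 / 2) - 1)) * H s = ennreal (?d * s powr (- 1 / 2))"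
        using 2 by (simp add: H_def ennreal_mult[symmetric])
      then show ?thesis using 2 by simp
    next
      case 3
      have "- (1 / 2) - 1 = (- 3 / 2 :: real)" by simp
      then show ?thesis using 3 by (simp add: H_def)
    qed simp
  qed
  also have "\<dots> < \<infinity>"
    using i1 i2 by (subst nn_integral_add) auto
  finally have "K < \<infinity>" .
  then obtain k where k: "K = ennreal k" "0 \<le> k" by (cases K) auto
  let ?\<kappa> = "2 powr (- (1 / 2) - 1) :: real"
  interpret sigma_finite_measure "lebesgue :: 'a measure" by (rule sigma_finite_lebesgue)
  have c0: "0 < (k + 1) / ?\<kappa> * 2 powr (1 / 2)" using k(2) by simp
  show ?thesis
  proof (intro exI[of _ "(k + 1) / ?\<kappa> * 2 powr (1 / 2)"] conjI allI impI c0)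
    fix U :: "'a \<Rightarrow> real" and z :: 'a and r :: real
    assume U[measurable]: "U \<in> borel_measurable lebesgue" and r: "0 < r"
      and pos: "0 < luxemburg \<F> (ball z (3 * r)) U"
    let ?B = "ball z r" and ?B3 = "ball z (3 * r)"
    let ?V = "\<lambda>x. U x * indicator ?B3 x"
    let ?G = "frac_maximal 0 \<F> ?V"
    have eB: "0 < emeasure lebesgue ?B" using r by (rule emeasure_lebesgue_ball_pos)
    show "(\<integral>\<^sup>+x\<in>?B. ennreal_powr (?G x) (1 / 2) \<partial>lebesgue)
      \<le> ennreal ((k + 1) / ?\<kappa> * 2 powr (1 / 2)) * ennreal_powr (luxemburg \<F> ?B3 U) (1 / 2) * emeasure lebesgue ?B"
    proof (cases "luxemburg \<F> ?B3 U")
      case top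
      have "ennreal ((k + 1) / ?\<kappa> * 2 powr (1 / 2)) \<noteq> 0" "emeasure lebesgue ?B \<noteq> 0"
        using c0 eB by (metis ennreal_eq_0_iff not_le, metis less_irrefl)
      then show ?thesis
        by (simp only: top ennreal_powr_top ennreal_mult_top ennreal_top_mult if_False top_greatest)
    next
      case (real e)
      have e: "0 < e" using real pos by simp
      \<comment> \<open>The factor 2 puts l strictly above the Luxemburg average, so that l is
        admissible; it is the origin of \<open>2 powr (1 / 2)\<close> in the constant.\<close>
      define l where "l = 2 * e"
      have l: "0 < l" using e by (simp add: l_def)
      have "luxemburg \<F> ?B3 U < ennreal l" using real e by (simp add: l_def ennreal_less_iff)
      from luxemburg_less[OF F _ this] r
      have int: "(\<integral>\<^sup>+x\<in>?B3. ennreal (\<F> (norm (U x) / l)) \<partial>lebesgue) \<le> emeasure lebesgue ?B3" by simp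
      also have "emeasure lebesgue ?B3 = ennreal (3 ^ DIM('a)) * emeasure lebesgue ?B"
        using r by (intro emeasure_lebesgue_ball_scale) auto
      finally have int: "(\<integral>\<^sup>+x\<in>?B3. ennreal (\<F> (norm (U x) / l)) \<partial>lebesgue)
          \<le> ennreal (3 ^ DIM('a)) * emeasure lebesgue ?B" .
      have V[measurable]: "?V \<in> borel_measurable lebesgue"
        by (intro borel_measurable_times U borel_measurable_indicator) simp
      have weak: "emeasure lebesgue {x\<in>?B. 1 < ?G x * ennreal t} \<le> H (l * t) * emeasure lebesgue ?B"
        if t: "0 < t" for t
      proof (cases "l * t \<le> 1")
        case False
        have "emeasure lebesgue {x\<in>?B. 1 < ?G x * ennreal t} \<le> emeasure lebesgue ?B"
          by (rule emeasure_mono) auto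
        with False show ?thesis by (simp add: H_def)
      next
        case True
        have "emeasure lebesgue {x\<in>?B. 1 < ?G x * ennreal t}
          \<le> ennreal (5 ^ DIM('a)) * (\<integral>\<^sup>+x. ennreal (\<F> (norm (?V x) * t)) \<partial>lebesgue)"
        proof (rule emeasure_le_of_ball_cover)
          show "(\<lambda>x. ennreal (\<F> (norm (?V x) * t))) \<in> borel_measurable lebesgue"
            using young_lebesgue_measurable[OF F V, of "1 / t"] t by simp
          fix x assume "x \<in> {x\<in>?B. 1 < ?G x * ennreal t}"
          then have "1 < ?G x * ennreal t" by simp
          from maximal_greaterE[OF this t] obtain y s where "0 < s" "x \<in> ball y s"
            "emeasure lebesgue (ball y s) < (\<integral>\<^sup>+z\<in>ball y s. ennreal (\<F> (norm (?V z) * t)) \<partial>lebesgue)" .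
          then show "\<exists>y s. 0 < s \<and> x \<in> ball y s \<and>
            emeasure lebesgue (ball y s) \<le> (\<integral>\<^sup>+z\<in>ball y s. ennreal (\<F> (norm (?V z) * t)) \<partial>lebesgue)"
            using less_imp_le by blast
        qed
        also have "(\<integral>\<^sup>+x. ennreal (\<F> (norm (?V x) * t)) \<partial>lebesgue)
            \<le> (\<integral>\<^sup>+x. ennreal (l * t) * (ennreal (\<F> (norm (U x) / l)) * indicator ?B3 x) \<partial>lebesgue)"
        proof (rule nn_integral_mono)
          fix x
          show "ennreal (\<F> (norm (?V x) * t))
            \<le> ennreal (l * t) * (ennreal (\<F> (norm (U x) / l)) * indicator ?B3 x)"
          proof (cases "x \<in> ?B3")
            case x: True
            have "\<F> ((l * t) * (norm (U x) / l)) \<le> (l * t) * \<F> (norm (U x) / l)"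
              using True l t by (intro young_scale[OF F]) auto
            then have "\<F> (norm (U x) * t) \<le> (l * t) * \<F> (norm (U x) / l)"
              using l by (simp add: mult.commute)
            then have "ennreal (\<F> (norm (U x) * t)) \<le> ennreal (l * t) * ennreal (\<F> (norm (U x) / l))"
              using l t by (subst ennreal_mult'[symmetric]) (auto intro: ennreal_leI)
            then show ?thesis using x by simp
          next
            case False
            have "\<F> 0 = 0" using F by (simp add: young_function_def)
            with False show ?thesis by simp
          qed
        qed
        also have "\<dots> = ennreal (l * t) * (\<integral>\<^sup>+x\<in>?B3. ennreal (\<F> (norm (U x) / l)) \<partial>lebesgue)"
          using young_ball_measurable[OF F U l] by (rule nn_integral_cmult)
        also have "\<dots> \<le> ennreal (l * t) * (ennreal (3 ^ DIM('a)) * emeasure lebesgue ?B)"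
          by (intro mult_left_mono int) simp
        finally have "emeasure lebesgue {x\<in>?B. 1 < ?G x * ennreal t}
          \<le> ennreal (5 ^ DIM('a)) * (ennreal (l * t) * (ennreal (3 ^ DIM('a)) * emeasure lebesgue ?B))"
          by (simp add: mult_left_mono)
        also have "\<dots> = ennreal (5 ^ DIM('a) * (l * t) * 3 ^ DIM('a)) * emeasure lebesgue ?B"
          using l t by (simp only: ennreal_mult mult.assoc zero_le_power zero_le_numeral
            mult_nonneg_nonneg less_imp_le)
        also have "5 ^ DIM('a) * (l * t) * 3 ^ DIM('a) = ?d * (l * t)"
        proof -
          have "?d = (5 * 3) ^ DIM('a)" by simp
          also have "\<dots> = 5 ^ DIM('a) * 3 ^ DIM('a)" by (rule power_mult_distrib)
          finally show ?thesis by (simp add: mult_ac)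
        qed
        finally show ?thesis using True by (simp add: H_def)
      qed
      have "ennreal ?\<kappa> * (\<integral>\<^sup>+x\<in>?B. ennreal_powr (?G x) (1 / 2) \<partial>lebesgue)
        \<le> (\<integral>\<^sup>+t\<in>{0<..}. ennreal (t powr (- (1 / 2) - 1)) * emeasure lebesgue {x\<in>?B. 1 < ?G x * ennreal t} \<partial>lborel)"
        by (rule layer_cake_le) auto
      also have "\<dots> \<le> (\<integral>\<^sup>+t. (ennreal (t powr (- (1 / 2) - 1)) * H (l * t) * indicator {0<..} t) * emeasure lebesgue ?B \<partial>lborel)"
      proof (rule nn_integral_mono)
        fix t :: real
        show "ennreal (t powr (- (1 / 2) - 1)) * emeasure lebesgue {x\<in>?B. 1 < ?G x * ennreal t} * indicator {0<..} t
          \<le> (ennreal (t powr (- (1 / 2) - 1)) * H (l * t) * indicator {0<..} t) * emeasure lebesgue ?B"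
        proof (cases "0 < t")
          case True
          from mult_left_mono[OF weak[OF True], of "ennreal (t powr (- (1 / 2) - 1))"] True
          show ?thesis by (simp add: mult.assoc)
        qed simp
      qed
      also have "\<dots> = (\<integral>\<^sup>+t\<in>{0<..}. ennreal (t powr (- (1 / 2) - 1)) * H (l * t) \<partial>lborel) * emeasure lebesgue ?B"
        by (rule nn_integral_multc) measurable
      also have "(\<integral>\<^sup>+t\<in>{0<..}. ennreal (t powr (- (1 / 2) - 1)) * H (l * t) \<partial>lborel) = ennreal (l powr (1 / 2)) * K"
        unfolding K_def by (rule nn_integral_powr_scale[OF H l])
      also have "ennreal (l powr (1 / 2)) * K \<le> ennreal (?\<kappa> * ((k + 1) / ?\<kappa> * 2 powr (1 / 2) * e powr (1 / 2)))"
        using e k by (simp add: l_def powr_mult ennreal_mult[symmetric] ennreal_leI mult_left_mono mult.commute)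
      also have "\<dots> = ennreal ?\<kappa> * (ennreal ((k + 1) / ?\<kappa> * 2 powr (1 / 2)) * ennreal_powr (luxemburg \<F> ?B3 U) (1 / 2))"
        unfolding real(2) ennreal_powr_ennreal[OF real(1)]
        using less_imp_le[OF c0] by (simp only: ennreal_mult' powr_ge_zero)
      finally have "ennreal ?\<kappa> * (\<integral>\<^sup>+x\<in>?B. ennreal_powr (?G x) (1 / 2) \<partial>lebesgue) \<le> ennreal ?\<kappa> *
         (ennreal ((k + 1) / ?\<kappa> * 2 powr (1 / 2)) * ennreal_powr (luxemburg \<F> ?B3 U) (1 / 2) * emeasure lebesgue ?B)"
        by (simp add: mult_right_mono mult.assoc)
      then show ?thesis
        by (subst (asm) ennreal_mult_le_mult_iff) (simp_all add: ennreal_eq_0_iff)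
    qed
  qed
qed

text \<open>The Coifman-Rochberg argument. For x in the ball B of radius r, a ball through x of
  radius at most r sees U only inside 3B, where the local estimate applies. A larger ball lies in a
  comparable ball that contains every y of B, so its contribution is at most a multiple of P at
  y.\<close>

lemma frac_maximal_half_power_a1:
  assumes F: "young_function \<F>" and \<alpha>: "0 \<le> \<alpha>"
    and U: "U \<in> borel_measurable lebesgue" and U0: "AE x in lebesgue. U x \<noteq> 0"
  shows "\<exists>C>0. a1_bound C (\<lambda>x::'a::euclidean_space. ennreal_powr (frac_maximal \<alpha> \<F> (U :: 'a \<Rightarrow> real) x) (1 / 2))"
proof -
  obtain C where C: "0 < C" and local: "\<And>(U::'a \<Rightarrow> real) z r. U \<in> borel_measurable lebesgue \<Longrightarrow> 0 < r \<Longrightarrow>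
    0 < luxemburg \<F> (ball z (3 * r)) U \<Longrightarrow>
    (\<integral>\<^sup>+x\<in>ball z r. ennreal_powr (frac_maximal 0 \<F> (\<lambda>x. U x * indicator (ball z (3 * r)) x) x) (1 / 2) \<partial>lebesgue)
      \<le> ennreal C * ennreal_powr (luxemburg \<F> (ball z (3 * r)) U) (1 / 2) * emeasure lebesgue (ball z r)"
    using maximal_half_power_bound[OF F, where 'a = 'a] by blast
  let ?n = "real DIM('a)" and ?P = "frac_maximal \<alpha> \<F> U"
  let ?k = "ennreal ((3 ^ DIM('a)) powr (1 / 2))"
  show ?thesis
    unfolding a1_bound_def
  proof (intro exI[of _ "C + (3 ^ DIM('a)) powr (1 / 2)"] conjI allI impI)
    show "0 < C + (3 ^ DIM('a)) powr (1 / 2)" using C by (simp add: add_pos_nonneg)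
    fix z y :: 'a and r :: real assume r: "0 < r" and y: "y \<in> ball z r"
    let ?B = "ball z r" and ?B3 = "ball z (3 * r)"
    let ?G = "frac_maximal 0 \<F> (\<lambda>x. U x * indicator ?B3 x)"
    let ?a = "ennreal (measure lebesgue ?B powr (\<alpha> / ?n))"
    have large: "ennreal (measure lebesgue (ball y' s) powr (\<alpha> / ?n)) * luxemburg \<F> (ball y' s) U
        \<le> ennreal (3 ^ DIM('a)) * ?P y" if s: "0 < s" "x \<in> ball y' s" "x \<in> ?B" "r < s" for x y' s
    proof -
      have sub: "ball y' s \<subseteq> ball z (3 * s)"
      proof
        fix w assume "w \<in> ball y' s"
        then have "dist y' w < s" "dist y' x < s" "dist z x < r" using s by auto
        then show "w \<in> ball z (3 * s)"
          using dist_triangle[of z w x] dist_triangle3[of x w y'] s(4) by simp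
      qed
      have y3: "y \<in> ball z (3 * s)" using y s by simp
      have "ennreal (measure lebesgue (ball y' s) powr (\<alpha> / ?n)) * luxemburg \<F> (ball y' s) U
        \<le> ennreal (measure lebesgue (ball z (3 * s)) powr (\<alpha> / ?n)) *
           (ennreal (3 ^ DIM('a)) * luxemburg \<F> (ball z (3 * s)) U)"
        using s(1) \<alpha> sub by (intro mult_mono ennreal_leI powr_mono2 measure_lebesgue_ball_mono
            luxemburg_enlarge[OF F U]) auto
      also have "\<dots> = ennreal (3 ^ DIM('a)) *
          (ennreal (measure lebesgue (ball z (3 * s)) powr (\<alpha> / ?n)) * luxemburg \<F> (ball z (3 * s)) U)"
        by (simp only: mult_ac)
      also have "\<dots> \<le> ennreal (3 ^ DIM('a)) * ?P y"
        using s(1) y3 by (intro mult_left_mono frac_maximal_upper) auto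
      finally show ?thesis .
    qed
    have small: "ennreal (measure lebesgue (ball y' s) powr (\<alpha> / ?n)) * luxemburg \<F> (ball y' s) U
        \<le> ?a * ?G x" if s: "0 < s" "x \<in> ball y' s" "x \<in> ?B" "s \<le> r" for x y' s
    proof (intro mult_mono ennreal_leI powr_mono2 measure_lebesgue_ball_mono)
      have sub: "w \<in> ?B3" if "w \<in> ball y' s" for w
      proof -
        have "dist y' w < s" "dist y' x < s" "dist z x < r" using s that by auto
        then show ?thesis
          using dist_triangle[of z w x] dist_triangle3[of x w y'] s(4) by simp
      qed
      have "luxemburg \<F> (ball y' s) U = luxemburg \<F> (ball y' s) (\<lambda>x. U x * indicator ?B3 x)"
        using sub by (intro luxemburg_cong) auto
      also have "\<dots> \<le> ?G x" by (rule luxemburg_le_maximal[OF s(1,2)])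
      finally show "luxemburg \<F> (ball y' s) U \<le> ?G x" .
    qed (use s \<alpha> in auto)
    have split: "?P x \<le> ?a * ?G x + ennreal (3 ^ DIM('a)) * ?P y" if x: "x \<in> ?B" for x
    proof (rule frac_maximal_least)
      fix y' s assume "0 < s" "x \<in> ball y' s"
      then show "ennreal (measure lebesgue (ball y' s) powr (\<alpha> / ?n)) * luxemburg \<F> (ball y' s) U
        \<le> ?a * ?G x + ennreal (3 ^ DIM('a)) * ?P y"
        using small[of s x y'] large[of s x y'] x by (cases "s \<le> r") (auto intro: add_increasing add_increasing2)
    qed
    \<comment> \<open>This turns the local estimate into one by P at y: 3B is itself a ball
      containing y, and the fractional factor of B is at most that of 3B because \<alpha> is
      nonnegative.\<close>
    have "?a * luxemburg \<F> ?B3 U \<le> ennreal (measure lebesgue ?B3 powr (\<alpha> / ?n)) * luxemburg \<F> ?B3 U"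
      using r \<alpha> by (intro mult_right_mono ennreal_leI powr_mono2 measure_lebesgue_ball_mono) auto
    also have "\<dots> \<le> ?P y" using r y by (intro frac_maximal_upper) auto
    finally have lux: "?a * luxemburg \<F> ?B3 U \<le> ?P y" .
    have Gm: "(\<lambda>x. ennreal_powr (?G x) (1 / 2) * indicator ?B x) \<in> borel_measurable lebesgue"
    proof (intro borel_measurable_times_ennreal borel_measurable_indicator)
      show "(\<lambda>x. ennreal_powr (?G x) (1 / 2)) \<in> borel_measurable lebesgue" by measurable
    qed simp
    have "(\<integral>\<^sup>+x\<in>?B. ennreal_powr (?P x) (1 / 2) \<partial>lebesgue)
      \<le> (\<integral>\<^sup>+x. ennreal_powr ?a (1 / 2) * (ennreal_powr (?G x) (1 / 2) * indicator ?B x)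
          + ?k * ennreal_powr (?P y) (1 / 2) * indicator ?B x \<partial>lebesgue)"
    proof (rule nn_integral_mono)
      fix x
      show "ennreal_powr (?P x) (1 / 2) * indicator ?B x
        \<le> ennreal_powr ?a (1 / 2) * (ennreal_powr (?G x) (1 / 2) * indicator ?B x)
          + ?k * ennreal_powr (?P y) (1 / 2) * indicator ?B x"
      proof (cases "x \<in> ?B")
        case True
        have "ennreal_powr (?P x) (1 / 2) \<le> ennreal_powr (?a * ?G x + ennreal (3 ^ DIM('a)) * ?P y) (1 / 2)"
          by (intro ennreal_powr_mono split True) simp
        also have "\<dots> \<le> ennreal_powr (?a * ?G x) (1 / 2) + ennreal_powr (ennreal (3 ^ DIM('a)) * ?P y) (1 / 2)"
          by (rule ennreal_powr_half_add)
        also have "\<dots> = ennreal_powr ?a (1 / 2) * ennreal_powr (?G x) (1 / 2) + ?k * ennreal_powr (?P y) (1 / 2)"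
          by (simp add: ennreal_powr_mult ennreal_powr_ennreal)
        finally show ?thesis using True by simp
      qed simp
    qed
    also have "\<dots> = ennreal_powr ?a (1 / 2) * (\<integral>\<^sup>+x\<in>?B. ennreal_powr (?G x) (1 / 2) \<partial>lebesgue)
        + ?k * ennreal_powr (?P y) (1 / 2) * emeasure lebesgue ?B"
    proof (subst nn_integral_add)
      show "(\<lambda>x. ennreal_powr ?a (1 / 2) * (ennreal_powr (?G x) (1 / 2) * indicator ?B x)) \<in> borel_measurable lebesgue"
        by (intro borel_measurable_times_ennreal Gm) simp
      show "(\<lambda>x. ?k * ennreal_powr (?P y) (1 / 2) * indicator ?B x) \<in> borel_measurable lebesgue"
        by (intro borel_measurable_times_ennreal borel_measurable_indicator) auto
    qed (simp add: nn_integral_cmult[OF Gm] nn_integral_cmult_indicator)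
    also have "\<dots> \<le> ennreal_powr ?a (1 / 2) *
          (ennreal C * ennreal_powr (luxemburg \<F> ?B3 U) (1 / 2) * emeasure lebesgue ?B)
        + ?k * ennreal_powr (?P y) (1 / 2) * emeasure lebesgue ?B"
      using r by (intro add_mono mult_left_mono local U luxemburg_pos[OF F U U0]) auto
    also have "ennreal_powr ?a (1 / 2) *
          (ennreal C * ennreal_powr (luxemburg \<F> ?B3 U) (1 / 2) * emeasure lebesgue ?B)
        = ennreal C * ennreal_powr (?a * luxemburg \<F> ?B3 U) (1 / 2) * emeasure lebesgue ?B"
      by (simp only: ennreal_powr_mult mult_ac)
    also have "\<dots> \<le> ennreal C * ennreal_powr (?P y) (1 / 2) * emeasure lebesgue ?B"
      by (intro mult_right_mono mult_left_mono ennreal_powr_mono lux) auto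
    finally show "(\<integral>\<^sup>+x\<in>?B. ennreal_powr (?P x) (1 / 2) \<partial>lebesgue)
      \<le> ennreal (C + (3 ^ DIM('a)) powr (1 / 2)) * ennreal_powr (?P y) (1 / 2) * emeasure lebesgue ?B"
      using C by (simp add: ring_distribs)
  qed
qed

section \<open>Linear changes of variables\<close>

text \<open>
  The change of variables theorems of the library need a well-ordered index type. A covering argument
  avoids this at the price of a worse constant.
\<close>

lemma nn_integral_matrix_le:
  fixes A :: "real ^ 'n ^ 'n"
  assumes "invertible A"
  shows "\<exists>C>0. \<forall>g::real ^ 'n \<Rightarrow> ennreal. g \<in> borel_measurable borel \<longrightarrow>
    (\<integral>\<^sup>+x. g (A *v x) \<partial>lebesgue) \<le> ennreal C * (\<integral>\<^sup>+x. g x \<partial>lebesgue)"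
proof -
  obtain A' where A': "A' ** A = mat 1" using assms by (auto simp: invertible_def)
  have lin: "bounded_linear (\<lambda>x. A' *v x)" by (rule matrix_vector_mul_bounded_linear)
  define L where "L = onorm (\<lambda>x. A' *v x) + 1"
  have L: "0 < L" using onorm_pos_le[OF lin] by (simp add: L_def)
  define c where "c = (L * 5) ^ DIM(real ^ 'n)"
  have c: "0 < c" using L by (simp add: c_def)
  have meas[measurable]: "(\<lambda>x. A *v x) \<in> borel_measurable borel"
    by (intro borel_measurable_continuous_onI matrix_vector_mult_linear_continuous_on)
  let ?N = "distr lborel borel (\<lambda>x. A *v x)"
  have ball: "emeasure ?N (ball y (5 * r)) \<le> ennreal c * emeasure lebesgue (ball y r)" if r: "0 < r" for y r
  proof -
    \<comment> \<open>The left inverse recovers x as A'(A x), so the preimage of a ball lies in a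
      ball whose radius is enlarged by the operator norm of A'. The summand 1 in L makes the factor
      positive even when that norm is not known to be.\<close>
    have "(\<lambda>x. A *v x) -` ball y (5 * r) \<subseteq> ball (A' *v y) (L * 5 * r)"
    proof
      fix x assume x: "x \<in> (\<lambda>x. A *v x) -` ball y (5 * r)"
      have "dist (A' *v y) x = norm (A' *v (y - A *v x))"
        by (simp add: dist_norm matrix_vector_mult_diff_distrib matrix_vector_mul_assoc A')
      also have "\<dots> \<le> onorm (\<lambda>x. A' *v x) * norm (y - A *v x)" by (rule onorm[OF lin])
      also have "\<dots> \<le> L * norm (y - A *v x)" by (intro mult_right_mono) (auto simp: L_def)
      also have "\<dots> < L * (5 * r)" using x L by (simp add: dist_norm)
      finally show "x \<in> ball (A' *v y) (L * 5 * r)" by simp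
    qed
    then have "emeasure lborel ((\<lambda>x. A *v x) -` ball y (5 * r)) \<le> emeasure lborel (ball (A' *v y) (L * 5 * r))"
      by (rule emeasure_mono) simp
    also have "\<dots> = ennreal c * emeasure lebesgue (ball y r)"
      using emeasure_lebesgue_ball_scale[OF r, of "L * 5" "A' *v y" y] L by (simp add: c_def)
    finally show ?thesis by (simp add: emeasure_distr)
  qed
  \<comment> \<open>For open U the covering lemma applies with h the indicator of U, because each
    point of U has a ball inside U. Outer regularity passes from open sets to Borel sets, and e / c
    is the excess that leaves an error e after multiplication by c.\<close>
  have "emeasure ?N S \<le> ennreal c * emeasure lborel S" if S: "S \<in> sets borel" for S
  proof (rule ennreal_le_epsilon)
    fix e :: real assume e: "0 < e"
    obtain U where U: "open U" "S \<subseteq> U" "emeasure lborel (U - S) < e / c"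
      using outer_regular_lborel[OF S, of "e / c"] e c by auto
    have "emeasure ?N S \<le> emeasure ?N U" using U by (intro emeasure_mono) auto
    also have "\<dots> \<le> ennreal c * (\<integral>\<^sup>+x. indicator U x \<partial>lebesgue)"
    proof (rule measure_le_of_ball_cover[OF _ _ c ball])
      fix x assume "x \<in> U"
      then obtain r where r: "0 < r" "ball x r \<subseteq> U" using U(1) openE by blast
      have "(\<integral>\<^sup>+z\<in>ball x r. indicator U z \<partial>lebesgue) = (\<integral>\<^sup>+z. indicator (ball x r) z \<partial>lebesgue)"
        using r(2) by (intro nn_integral_cong) (auto simp: indicator_def)
      then show "\<exists>y r. 0 < r \<and> x \<in> ball y r \<and>
          emeasure lebesgue (ball y r) \<le> (\<integral>\<^sup>+z\<in>ball y r. indicator U z \<partial>lebesgue)"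
        using r(1) by (intro exI[of _ x] exI[of _ r]) simp
    qed (use U(1) in \<open>auto intro!: borel_measurable_indicator\<close>)
    also have "(\<integral>\<^sup>+x. indicator U x \<partial>lebesgue) = emeasure lborel (S \<union> (U - S))"
      using U(1,2) by (simp add: Un_absorb1)
    also have "\<dots> \<le> emeasure lborel S + emeasure lborel (U - S)"
      using S U(1) by (intro emeasure_subadditive) auto
    also have "\<dots> \<le> emeasure lborel S + ennreal (e / c)" using U(3) by (intro add_left_mono) auto
    finally have "emeasure ?N S \<le> ennreal c * (emeasure lborel S + ennreal (e / c))"
      by (simp add: mult_left_mono)
    also have "\<dots> = ennreal c * emeasure lborel S + ennreal e"
      using c e by (simp add: ring_distribs ennreal_mult[symmetric])
    finally show "emeasure ?N S \<le> ennreal c * emeasure lborel S + ennreal e" .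
  qed
  then have le: "?N \<le> scale_measure (ennreal c) lborel"
    by (subst le_measure) auto
  show ?thesis
  proof (intro exI[of _ c] conjI allI impI c)
    fix g :: "real ^ 'n \<Rightarrow> ennreal" assume g[measurable]: "g \<in> borel_measurable borel"
    have "(\<integral>\<^sup>+x. g (A *v x) \<partial>lebesgue) = (\<integral>\<^sup>+x. g (A *v x) \<partial>lborel)"
      by (rule nn_integral_completion)
    also have "\<dots> = (\<integral>\<^sup>+x. g x \<partial>?N)"
      by (rule nn_integral_distr[symmetric]) simp_all
    also have "\<dots> \<le> (\<integral>\<^sup>+x. g x \<partial>scale_measure (ennreal c) lborel)"
      using le by (intro nn_integral_mono_measure) simp_all
    also have "\<dots> = ennreal c * (\<integral>\<^sup>+x. g x \<partial>lborel)"
      by (rule nn_integral_scale_measure) simp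
    also have "(\<integral>\<^sup>+x. g x \<partial>lborel) = (\<integral>\<^sup>+x. g x \<partial>lebesgue)"
      by (rule nn_integral_completion[symmetric])
    finally show "(\<integral>\<^sup>+x. g (A *v x) \<partial>lebesgue) \<le> ennreal c * (\<integral>\<^sup>+x. g x \<partial>lebesgue)" .
  qed
qed

text \<open>A maps the ball around z into the ball around A z with radius enlarged by L. The change
  of variables moves the integral there, the bound for G is applied at A y, and the ratio of the
  measures of the two balls is a constant.\<close>

lemma a1_bound_matrix:
  fixes A :: "real ^ 'n ^ 'n" and G :: "real ^ 'n \<Rightarrow> ennreal"
  assumes A: "invertible A" and G[measurable]: "G \<in> borel_measurable borel" and C: "0 < C" "a1_bound C G"
  shows "\<exists>C'>0. a1_bound C' (\<lambda>x. G (A *v x))"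
proof -
  obtain D where D: "0 < D" "\<And>g::real ^ 'n \<Rightarrow> ennreal. g \<in> borel_measurable borel \<Longrightarrow>
    (\<integral>\<^sup>+x. g (A *v x) \<partial>lebesgue) \<le> ennreal D * (\<integral>\<^sup>+x. g x \<partial>lebesgue)"
    using nn_integral_matrix_le[OF A] by blast
  have lin: "bounded_linear (\<lambda>x. A *v x)" by (rule matrix_vector_mul_bounded_linear)
  define L where "L = onorm (\<lambda>x. A *v x) + 1"
  have L: "0 < L" using onorm_pos_le[OF lin] by (simp add: L_def)
  let ?K = "L ^ DIM(real ^ 'n)"
  have K: "0 < ?K" using L by simp
  show ?thesis
    unfolding a1_bound_def
  proof (intro exI[of _ "D * C * ?K"] conjI allI impI)
    show "0 < D * C * ?K" using D C K by simp
    fix z y :: "real ^ 'n" and r :: real assume r: "0 < r" and y: "y \<in> ball z r"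
    let ?B = "ball (A *v z) (L * r)"
    have mem: "A *v x \<in> ?B" if "x \<in> ball z r" for x
    proof -
      have "dist (A *v z) (A *v x) = norm (A *v (z - x))"
        by (simp add: dist_norm matrix_vector_mult_diff_distrib)
      also have "\<dots> \<le> onorm (\<lambda>x. A *v x) * norm (z - x)" by (rule onorm[OF lin])
      also have "\<dots> \<le> L * norm (z - x)" by (intro mult_right_mono) (auto simp: L_def)
      also have "\<dots> < L * r" using that L by (simp add: dist_norm)
      finally show ?thesis by simp
    qed
    have "(\<integral>\<^sup>+x\<in>ball z r. G (A *v x) \<partial>lebesgue) \<le> (\<integral>\<^sup>+x. G (A *v x) * indicator ?B (A *v x) \<partial>lebesgue)"
      using mem by (intro nn_integral_mono) (auto simp del: mem_ball simp: indicator_def)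
    also have "\<dots> \<le> ennreal D * (\<integral>\<^sup>+x\<in>?B. G x \<partial>lebesgue)"
      by (intro D(2) borel_measurable_times_ennreal G borel_measurable_indicator) auto
    also have "\<dots> \<le> ennreal D * (ennreal C * G (A *v y) * emeasure lebesgue ?B)"
      using C(2) mem[OF y] L r unfolding a1_bound_def by (intro mult_left_mono) auto
    also have "emeasure lebesgue ?B = ennreal ?K * emeasure lebesgue (ball z r)"
      using r L by (intro emeasure_lebesgue_ball_scale) auto
    also have "ennreal D * (ennreal C * G (A *v y) * (ennreal ?K * emeasure lebesgue (ball z r)))
        = ennreal (D * C * ?K) * G (A *v y) * emeasure lebesgue (ball z r)"
      using D C K by (simp add: ennreal_mult mult_ac)
    finally show "(\<integral>\<^sup>+x\<in>ball z r. G (A *v x) \<partial>lebesgue)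
      \<le> ennreal (D * C * ?K) * G (A *v y) * emeasure lebesgue (ball z r)" .
  qed
qed

section \<open>Sums and finiteness under the A_1 condition\<close>

lemma a1_bound_mono:
  fixes G :: "'a::euclidean_space \<Rightarrow> ennreal"
  assumes "a1_bound C G" "C \<le> C'"
  shows "a1_bound C' G"
  unfolding a1_bound_def
proof (intro allI impI)
  fix z y :: 'a and r :: real assume "0 < r" "y \<in> ball z r"
  then have "(\<integral>\<^sup>+x\<in>ball z r. G x \<partial>lebesgue) \<le> ennreal C * G y * emeasure lebesgue (ball z r)"
    using assms(1) by (simp add: a1_bound_def)
  also have "\<dots> \<le> ennreal C' * G y * emeasure lebesgue (ball z r)"
    using assms(2) by (intro mult_right_mono ennreal_leI) auto
  finally show "(\<integral>\<^sup>+x\<in>ball z r. G x \<partial>lebesgue) \<le> ennreal C' * G y * emeasure lebesgue (ball z r)" .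
qed

lemma a1_bound_sum:
  fixes G :: "'i \<Rightarrow> 'a::euclidean_space \<Rightarrow> ennreal"
  assumes "finite I" and G: "\<And>i. i \<in> I \<Longrightarrow> G i \<in> borel_measurable lebesgue"
    and "\<And>i. i \<in> I \<Longrightarrow> \<exists>C>0. a1_bound C (G i)"
  shows "\<exists>C>0. a1_bound C (\<lambda>x. \<Sum>i\<in>I. G i x)"
proof -
  obtain D where D: "\<And>i. i \<in> I \<Longrightarrow> 0 < D i \<and> a1_bound (D i) (G i)"
    using assms(3) by metis
  \<comment> \<open>The sum of the constants dominates each of them; the summand 1 keeps the
    constant positive when I is empty.\<close>
  let ?C = "1 + (\<Sum>i\<in>I. D i)"
  have C: "D i \<le> ?C" if "i \<in> I" for i
    using member_le_sum[of i I D] that assms(1) D by (force intro: less_imp_le)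
  have "a1_bound ?C (\<lambda>x. \<Sum>i\<in>I. G i x)"
    unfolding a1_bound_def
  proof (intro allI impI)
    fix z y :: 'a and r :: real assume r: "0 < r" "y \<in> ball z r"
    have "(\<integral>\<^sup>+x\<in>ball z r. (\<Sum>i\<in>I. G i x) \<partial>lebesgue) = (\<integral>\<^sup>+x. (\<Sum>i\<in>I. G i x * indicator (ball z r) x) \<partial>lebesgue)"
      by (simp add: sum_distrib_right)
    also have "\<dots> = (\<Sum>i\<in>I. \<integral>\<^sup>+x\<in>ball z r. G i x \<partial>lebesgue)"
      by (intro nn_integral_sum borel_measurable_times_ennreal G borel_measurable_indicator) auto
    also have "\<dots> \<le> (\<Sum>i\<in>I. ennreal ?C * G i y * emeasure lebesgue (ball z r))"
    proof (rule sum_mono)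
      fix i assume "i \<in> I"
      then have "a1_bound ?C (G i)" using D C a1_bound_mono by blast
      then show "(\<integral>\<^sup>+x\<in>ball z r. G i x \<partial>lebesgue) \<le> ennreal ?C * G i y * emeasure lebesgue (ball z r)"
        using r unfolding a1_bound_def by blast
    qed
    also have "\<dots> = ennreal ?C * (\<Sum>i\<in>I. G i y) * emeasure lebesgue (ball z r)"
      by (simp only: sum_distrib_left sum_distrib_right)
    finally show "(\<integral>\<^sup>+x\<in>ball z r. (\<Sum>i\<in>I. G i x) \<partial>lebesgue)
      \<le> ennreal ?C * (\<Sum>i\<in>I. G i y) * emeasure lebesgue (ball z r)" .
  qed
  moreover have "0 < ?C" using D by (intro add_pos_nonneg sum_nonneg) (auto intro: less_imp_le)
  ultimately show ?thesis by blast
qed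

text \<open>The bound holds at every point of a ball, not only almost everywhere, so a single point
  where G is finite makes G integrable on all balls around it.\<close>

lemma a1_bound_AE_finite:
  fixes x0 :: "'a::euclidean_space"
  assumes C: "a1_bound C G" and G: "G \<in> borel_measurable lebesgue" and x0: "G x0 < \<infinity>"
  shows "AE x in lebesgue. G x < \<infinity>"
proof -
  have "AE x in lebesgue. \<forall>n::nat. x \<in> ball x0 (Suc n) \<longrightarrow> G x < \<infinity>"
  proof (rule AE_all_countable[THEN iffD2], intro allI)
    fix n :: nat
    let ?B = "ball x0 (Suc n)"
    have "(\<integral>\<^sup>+x\<in>?B. G x \<partial>lebesgue) \<le> ennreal C * G x0 * emeasure lebesgue ?B"
      using C unfolding a1_bound_def by auto
    also have "\<dots> < \<infinity>"
      using x0 emeasure_lebesgue_ball_finite[of x0 "Suc n"] by (simp add: ennreal_mult_less_top)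
    finally have "(\<integral>\<^sup>+x. G x * indicator ?B x \<partial>lebesgue) \<noteq> \<infinity>" by simp
    then have "AE x in lebesgue. G x * indicator ?B x \<noteq> \<infinity>"
      by (intro nn_integral_noteq_infinite borel_measurable_times_ennreal G borel_measurable_indicator) auto
    then show "AE x in lebesgue. x \<in> ?B \<longrightarrow> G x < \<infinity>"
      by eventually_elim (auto simp: top.not_eq_extremum)
  qed
  then show ?thesis
  proof eventually_elim
    fix x assume *: "\<forall>n::nat. x \<in> ball x0 (Suc n) \<longrightarrow> G x < \<infinity>"
    obtain n :: nat where "dist x0 x < real n" using reals_Archimedean2 by blast
    then show "G x < \<infinity>" using *[rule_format, of n] by simp
  qed
qed

text \<open>Duality of the Muckenhoupt classes. For w = Q^(-s) and exponent s + 1 the dual power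
  w^(-1/s) is Q itself, and the A_1 bound says that Q is at least its average divided by C. So the
  average of w is at most C^s times the average of Q to the power -s, and the product in the
  definition is at most C^s.\<close>

lemma A_infinity_negative_power:
  fixes Q :: "'a::euclidean_space \<Rightarrow> ennreal"
  assumes Q[measurable]: "Q \<in> borel_measurable lebesgue" and pos: "\<And>x. 0 < Q x"
    and fin: "AE x in lebesgue. Q x < \<infinity>" and C: "0 < C" "a1_bound C Q" and s: "0 < s"
  shows "(\<lambda>x. enn2real (Q x) powr (- s)) \<in> A_infinity"
proof -
  let ?w = "\<lambda>x. enn2real (Q x) powr (- s)"
  have [measurable]: "?w \<in> borel_measurable lebesgue" by measurable
  have avg: "\<exists>a>0. (\<integral>\<^sup>+x\<in>ball z r. Q x \<partial>lebesgue) \<le> ennreal a * emeasure lebesgue (ball z r) \<and>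
      (\<forall>y\<in>ball z r. ?w y \<le> (a / C) powr (- s))" if r: "0 < r" for z r
  proof -
    let ?B = "ball z r"
    obtain b where b: "emeasure lebesgue ?B = ennreal b" "0 < b"
      using emeasure_lebesgue_ball_finite[of z r] emeasure_lebesgue_ball_pos[OF r, of z]
      by (cases "emeasure lebesgue ?B") auto
    \<comment> \<open>Q is finite almost everywhere, hence somewhere in the ball; the A_1 bound at
      that point makes the average of Q over the ball finite. Positivity of Q makes it nonzero, so
      it can serve as the number a.\<close>
    have "\<exists>y\<in>?B. Q y < \<infinity>"
    proof (rule ccontr)
      assume "\<not> (\<exists>y\<in>?B. Q y < \<infinity>)"
      with fin have "AE x in lebesgue. x \<notin> ?B" by (auto elim: eventually_mono)
      then have "emeasure lebesgue ?B = 0" by (subst (asm) AE_iff_measurable[of ?B]) auto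
      with b show False by simp
    qed
    then obtain y0 where y0: "y0 \<in> ?B" "Q y0 < \<infinity>" by blast
    have le: "(\<integral>\<^sup>+x\<in>?B. Q x \<partial>lebesgue) \<le> ennreal C * Q y * ennreal b" if "y \<in> ?B" for y
      using C(2) r that b unfolding a1_bound_def by metis
    have "ennreal C * Q y0 * ennreal b < \<infinity>" using y0(2) by (simp add: ennreal_mult_less_top)
    then have "(\<integral>\<^sup>+x\<in>?B. Q x \<partial>lebesgue) < \<infinity>" using le[OF y0(1)] by (rule le_less_trans[rotated])
    then obtain j where j: "(\<integral>\<^sup>+x\<in>?B. Q x \<partial>lebesgue) = ennreal j" "0 \<le> j"
      by (cases "\<integral>\<^sup>+x\<in>?B. Q x \<partial>lebesgue") auto
    have "j \<noteq> 0"
    proof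
      assume "j = 0"
      then have "(\<integral>\<^sup>+x. Q x * indicator ?B x \<partial>lebesgue) = 0" using j by simp
      then have "AE x in lebesgue. Q x * indicator ?B x = 0"
        by (subst (asm) nn_integral_0_iff_AE) (auto intro!: borel_measurable_times_ennreal Q borel_measurable_indicator)
      then have "AE x in lebesgue. x \<notin> ?B"
        by eventually_elim (use pos in \<open>auto simp: indicator_def less_le split: if_splits\<close>)
      then have "emeasure lebesgue ?B = 0" by (subst (asm) AE_iff_measurable[of ?B]) auto
      with b show False by simp
    qed
    with j have j0: "0 < j" by simp
    show ?thesis
    proof (intro exI[of _ "j / b"] conjI ballI)
      show "0 < j / b" using j0 b by simp
      show "(\<integral>\<^sup>+x\<in>?B. Q x \<partial>lebesgue) \<le> ennreal (j / b) * emeasure lebesgue ?B"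
        using b j by (simp add: ennreal_mult[symmetric])
      fix y assume y: "y \<in> ?B"
      show "?w y \<le> (j / b / C) powr (- s)"
      \<comment> \<open>Where Q y = top, \<open>enn2real\<close> gives 0 and
        \<open>0 powr (- s)\<close> is 0, so the bound holds by the default values.\<close>
      proof (cases "Q y")
        case (real q)
        have "ennreal j \<le> ennreal (C * q * b)"
          using le[OF y] real C b unfolding j(1) by (simp add: ennreal_mult)
        then have "j \<le> C * q * b" using real C b by simp
        then have "j / b / C \<le> q" using b C by (simp add: field_simps)
        then show ?thesis using real j0 b C s by (auto intro!: powr_mono2')
      qed simp
    qed
  qed
  have bdd: "(\<integral>\<^sup>+x\<in>ball z r. ennreal (?w x) \<partial>lebesgue) \<le> ennreal K * emeasure lebesgue (ball z r)"
    if "\<forall>y\<in>ball z r. ?w y \<le> K" for z r K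
  proof -
    have "(\<integral>\<^sup>+x\<in>ball z r. ennreal (?w x) \<partial>lebesgue) \<le> (\<integral>\<^sup>+x. ennreal K * indicator (ball z r) x \<partial>lebesgue)"
      using that by (intro nn_integral_mono) (auto simp: indicator_def simp del: mem_ball intro!: ennreal_leI)
    also have "\<dots> = ennreal K * emeasure lebesgue (ball z r)" by (rule nn_integral_cmult_indicator) simp
    finally show ?thesis .
  qed
  have "weight ?w"
    unfolding weight_def locally_integrable_def
  proof (intro conjI allI impI)
    fix K :: "'a set" assume "compact K"
    then obtain R where R: "0 < R" "K \<subseteq> ball 0 R" using bounded_subset_ballD[OF compact_imp_bounded, of K 0] by auto
    obtain a where a: "\<forall>y\<in>ball 0 R. ?w y \<le> (a / C) powr (- s)" using avg[OF R(1)] by blast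
    have "K \<in> lmeasurable" using \<open>compact K\<close> by (rule lmeasurable_compact)
    then have K: "K \<in> sets lebesgue" "emeasure lebesgue K < \<infinity>" by (auto simp: fmeasurable_def)
    show "set_integrable lebesgue K ?w"
      unfolding set_integrable_def
    proof (rule integrableI_bounded_set_indicator[OF K(1) _ K(2)])
      show "AE x in lebesgue. x \<in> K \<longrightarrow> norm (?w x) \<le> (a / C) powr (- s)"
        using a R(2) by (intro AE_I2) auto
    qed simp
  next
    show "AE x in lebesgue. 0 < ?w x"
      using fin
    proof eventually_elim
      fix x assume "Q x < \<infinity>"
      then show "0 < ?w x" using pos[of x] by (cases "Q x") auto
    qed
  qed auto
  moreover have "average (ball z r) (\<lambda>x. ennreal (?w x)) *
      ennreal_powr (average (ball z r) (\<lambda>x. ennreal (?w x powr (- 1 / s)))) s \<le> ennreal (C powr s)"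
    if r: "0 < r" for z r
  proof -
    obtain a where a: "0 < a" "(\<integral>\<^sup>+x\<in>ball z r. Q x \<partial>lebesgue) \<le> ennreal a * emeasure lebesgue (ball z r)"
        "\<forall>y\<in>ball z r. ?w y \<le> (a / C) powr (- s)" using avg[OF r] by blast
    have "ennreal (?w x powr (- 1 / s)) \<le> Q x" for x
      using s by (cases "Q x") (auto simp: powr_powr)
    then have "(\<integral>\<^sup>+x\<in>ball z r. ennreal (?w x powr (- 1 / s)) \<partial>lebesgue) \<le> (\<integral>\<^sup>+x\<in>ball z r. Q x \<partial>lebesgue)"
      by (intro nn_integral_mono mult_right_mono) auto
    then have "average (ball z r) (\<lambda>x. ennreal (?w x powr (- 1 / s))) \<le> ennreal a"
      using a(2) average_le_iff[OF r] order_trans by blast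
    then have "ennreal_powr (average (ball z r) (\<lambda>x. ennreal (?w x powr (- 1 / s)))) s \<le> ennreal_powr (ennreal a) s"
      using s by (intro ennreal_powr_mono) auto
    moreover have "average (ball z r) (\<lambda>x. ennreal (?w x)) \<le> ennreal ((a / C) powr (- s))"
      using bdd[OF a(3)] by (simp add: average_le_iff[OF r])
    ultimately have "average (ball z r) (\<lambda>x. ennreal (?w x)) *
      ennreal_powr (average (ball z r) (\<lambda>x. ennreal (?w x powr (- 1 / s)))) s
      \<le> ennreal ((a / C) powr (- s)) * ennreal_powr (ennreal a) s"
      by (intro mult_mono) auto
    also have "\<dots> = ennreal ((a / C) powr (- s) * a powr s)"
      using a(1) by (simp add: ennreal_powr_ennreal ennreal_mult)
    also have "(a / C) powr (- s) * a powr s = C powr s"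
      using a(1) C(1) by (simp add: powr_divide powr_minus field_simps)
    finally show ?thesis .
  qed
  ultimately have "muckenhoupt (s + 1) ?w"
    using s unfolding muckenhoupt_def by auto
  then show ?thesis using s unfolding A_infinity_def by (intro UN_I[of "s + 1"]) auto
qed

section \<open>Duality\<close>

text \<open>Writing |h| as |h|/U times U, Hoelder's inequality gives a factor P(A_i x)^q, which the
  weight cancels for each i because P(A_i x)^(1/2) is one of the summands of Q(x). What remains is
  the maximal operator of \<E> at A_i x, and its L^q bound applies after the change of
  variables.\<close>

lemma maximal_weighted_bound:
  fixes A :: "'i \<Rightarrow> real ^ 'n ^ 'n" and U :: "real ^ 'n \<Rightarrow> real"
  assumes \<phi>: "young_function \<phi>" and \<E>: "young_function \<E>" and \<F>: "young_function \<F>"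
    and inv: "\<forall>t\<ge>0. young_inverse \<E> t * young_inverse \<F> t \<le> young_inverse \<phi> t"
    and B: "B_class q \<E>" and q: "1 < q"
    and I: "finite I" and A: "\<And>i. i \<in> I \<Longrightarrow> invertible (A i)"
    and U[measurable]: "U \<in> borel_measurable lebesgue" and U0: "AE x in lebesgue. 0 < U x"
    and Q: "Q = (\<lambda>x. \<Sum>i\<in>I. ennreal_powr (frac_maximal \<alpha> \<F> U (A i *v x)) (1 / 2))"
    and fin: "AE x in lebesgue. Q x < \<infinity>"
  shows "\<exists>C>0. \<forall>h::real ^ 'n \<Rightarrow> 'b::{real_normed_vector, second_countable_topology}.
    h \<in> borel_measurable lebesgue \<longrightarrow>
    (\<integral>\<^sup>+x. (\<Sum>i\<in>I. ennreal_powr (frac_maximal \<alpha> \<phi> h (A i *v x)) q) * ennreal (enn2real (Q x) powr (- (2 * q))) \<partial>lebesgue)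
      \<le> ennreal C * (\<integral>\<^sup>+x. ennreal (norm (h x) powr q * U x powr (- q)) \<partial>lebesgue)"
proof -
  let ?P = "frac_maximal \<alpha> \<F> U"
  obtain C where C: "0 < C" and strong: "\<And>g::real ^ 'n \<Rightarrow> real. g \<in> borel_measurable lebesgue \<Longrightarrow>
      (\<integral>\<^sup>+x. ennreal_powr (frac_maximal 0 \<E> g x) q \<partial>lebesgue)
        \<le> ennreal C * (\<integral>\<^sup>+x. ennreal (\<bar>g x\<bar> powr q) \<partial>lebesgue)"
    using maximal_strong_type[OF \<E> B q, where 'a = "real ^ 'n"] by blast
  have "\<exists>D>0. \<forall>g::real ^ 'n \<Rightarrow> ennreal. g \<in> borel_measurable borel \<longrightarrow>
      (\<integral>\<^sup>+x. g (A i *v x) \<partial>lebesgue) \<le> ennreal D * (\<integral>\<^sup>+x. g x \<partial>lebesgue)" if "i \<in> I" for i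
    using nn_integral_matrix_le[OF A[OF that]] .
  then obtain D where D: "\<And>i. i \<in> I \<Longrightarrow> 0 < D i"
      "\<And>i (g::real ^ 'n \<Rightarrow> ennreal). i \<in> I \<Longrightarrow> g \<in> borel_measurable borel \<Longrightarrow>
        (\<integral>\<^sup>+x. g (A i *v x) \<partial>lebesgue) \<le> ennreal (D i) * (\<integral>\<^sup>+x. g x \<partial>lebesgue)" by metis
  \<comment> \<open>4 comes from Hoelder's inequality for the maximal functions, C from the strong
    type bound, D i from the change of variables; the summand 1 keeps the constant positive when I
    is empty.\<close>
  let ?K = "4 powr q * C * (\<Sum>i\<in>I. D i) + 1"
  have D0: "0 \<le> (\<Sum>i\<in>I. D i)" using D(1) by (intro sum_nonneg) (auto intro: less_imp_le)
  have U_nz: "AE x in lebesgue. U x \<noteq> 0" using U0 by (rule eventually_mono) simp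
  show ?thesis
  proof (intro exI[of _ ?K] conjI allI impI)
    show "0 < ?K" using C D0 by (intro add_nonneg_pos mult_nonneg_nonneg) auto
    fix h :: "real ^ 'n \<Rightarrow> 'b" assume h[measurable]: "h \<in> borel_measurable lebesgue"
    define k where "k x = norm (h x) / U x" for x
    have k[measurable]: "k \<in> borel_measurable lebesgue" unfolding k_def by measurable
    have hk: "AE x in lebesgue. norm (h x) = norm (k x) * norm (U x)"
      using U0 by eventually_elim (simp add: k_def)
    let ?M = "frac_maximal 0 \<E> k"
    have M[measurable]: "?M \<in> borel_measurable borel" by (rule borel_measurable_frac_maximal)
    have lin[measurable]: "(\<lambda>x. A i *v x) \<in> borel_measurable borel" for i
      by (intro borel_measurable_continuous_onI matrix_vector_mult_linear_continuous_on)
    have MA: "(\<lambda>x. ennreal_powr (?M (A i *v x)) q) \<in> borel_measurable lebesgue" for i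
    proof -
      have "(\<lambda>x. ennreal_powr (?M (A i *v x)) q) \<in> borel_measurable lborel" by measurable
      then show ?thesis by (rule measurable_completion)
    qed
    let ?I = "\<integral>\<^sup>+x. ennreal (norm (h x) powr q * U x powr (- q)) \<partial>lebesgue"
    have "AE x in lebesgue. (\<Sum>i\<in>I. ennreal_powr (frac_maximal \<alpha> \<phi> h (A i *v x)) q) * ennreal (enn2real (Q x) powr (- (2 * q)))
        \<le> (\<Sum>i\<in>I. ennreal (4 powr q) * ennreal_powr (?M (A i *v x)) q)"
      using fin
    proof eventually_elim
      fix x assume Qx: "Q x < \<infinity>"
      then obtain s where s: "Q x = ennreal s" "0 \<le> s" by (cases "Q x") auto
      show "(\<Sum>i\<in>I. ennreal_powr (frac_maximal \<alpha> \<phi> h (A i *v x)) q) * ennreal (enn2real (Q x) powr (- (2 * q)))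
        \<le> (\<Sum>i\<in>I. ennreal (4 powr q) * ennreal_powr (?M (A i *v x)) q)"
        unfolding sum_distrib_right
      proof (rule sum_mono)
        fix i assume i: "i \<in> I"
        have le: "ennreal_powr (?P (A i *v x)) (1 / 2) \<le> Q x"
          unfolding Q using I i by (intro member_le_sum) auto
        then have Pf: "?P (A i *v x) < \<infinity>" using Qx by (cases "?P (A i *v x)") auto
        have "0 < ?P (A i *v x)" by (rule frac_maximal_pos[OF \<F> U U_nz])
        with Pf obtain b where b: "?P (A i *v x) = ennreal b" "0 < b" by (cases "?P (A i *v x)") auto
        have bs: "b powr (1 / 2) \<le> s" using le b s by (simp add: ennreal_powr_ennreal)
        have "s powr (- (2 * q)) \<le> (b powr (1 / 2)) powr (- (2 * q))"
          using bs b q by (intro powr_mono2') auto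
        also have "\<dots> = b powr (- q)" by (simp add: powr_powr)
        finally have w: "enn2real (Q x) powr (- (2 * q)) \<le> b powr (- q)" using s by simp
        have "frac_maximal \<alpha> \<phi> h (A i *v x) \<le> 4 * ?M (A i *v x) * ennreal b"
          using frac_maximal_hoelder[OF \<phi> \<E> \<F> inv k U hk U_nz Pf] b by simp
        then have "ennreal_powr (frac_maximal \<alpha> \<phi> h (A i *v x)) q \<le> ennreal_powr (4 * ?M (A i *v x) * ennreal b) q"
          using q by (intro ennreal_powr_mono) auto
        also have "\<dots> = ennreal (4 powr q) * ennreal_powr (?M (A i *v x)) q * ennreal (b powr q)"
          using b ennreal_powr_ennreal[of 4 q] by (simp add: ennreal_powr_mult ennreal_powr_ennreal)
        finally have "ennreal_powr (frac_maximal \<alpha> \<phi> h (A i *v x)) q * ennreal (enn2real (Q x) powr (- (2 * q)))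
          \<le> ennreal (4 powr q) * ennreal_powr (?M (A i *v x)) q * ennreal (b powr q) * ennreal (b powr (- q))"
          using w by (intro mult_mono ennreal_leI) auto
        also have "\<dots> = ennreal (4 powr q) * ennreal_powr (?M (A i *v x)) q * ennreal (b powr q * b powr (- q))"
          by (simp add: ennreal_mult mult.assoc)
        also have "b powr q * b powr (- q) = 1" using b by (simp add: powr_minus)
        finally show "ennreal_powr (frac_maximal \<alpha> \<phi> h (A i *v x)) q * ennreal (enn2real (Q x) powr (- (2 * q)))
          \<le> ennreal (4 powr q) * ennreal_powr (?M (A i *v x)) q" by simp
      qed
    qed
    then have "(\<integral>\<^sup>+x. (\<Sum>i\<in>I. ennreal_powr (frac_maximal \<alpha> \<phi> h (A i *v x)) q) * ennreal (enn2real (Q x) powr (- (2 * q))) \<partial>lebesgue)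
        \<le> (\<integral>\<^sup>+x. (\<Sum>i\<in>I. ennreal (4 powr q) * ennreal_powr (?M (A i *v x)) q) \<partial>lebesgue)"
      by (rule nn_integral_mono_AE)
    also have "\<dots> = (\<Sum>i\<in>I. \<integral>\<^sup>+x. ennreal (4 powr q) * ennreal_powr (?M (A i *v x)) q \<partial>lebesgue)"
      by (intro nn_integral_sum borel_measurable_times_ennreal MA) simp
    also have "\<dots> = (\<Sum>i\<in>I. ennreal (4 powr q) * (\<integral>\<^sup>+x. ennreal_powr (?M (A i *v x)) q \<partial>lebesgue))"
      by (intro sum.cong refl nn_integral_cmult MA)
    also have "\<dots> \<le> (\<Sum>i\<in>I. ennreal (4 powr q) * (ennreal (D i) * (ennreal C * ?I)))"
    proof (intro sum_mono mult_left_mono)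
      fix i assume i: "i \<in> I"
      have "(\<integral>\<^sup>+x. ennreal_powr (?M (A i *v x)) q \<partial>lebesgue)
          \<le> ennreal (D i) * (\<integral>\<^sup>+x. ennreal_powr (?M x) q \<partial>lebesgue)"
        by (rule D(2)[OF i]) measurable
      also have "\<dots> \<le> ennreal (D i) * (ennreal C * (\<integral>\<^sup>+x. ennreal (\<bar>k x\<bar> powr q) \<partial>lebesgue))"
        by (intro mult_left_mono strong k) simp
      also have "(\<integral>\<^sup>+x. ennreal (\<bar>k x\<bar> powr q) \<partial>lebesgue) = ?I"
      proof (rule nn_integral_cong_AE)
        show "AE x in lebesgue. ennreal (\<bar>k x\<bar> powr q) = ennreal (norm (h x) powr q * U x powr (- q))"
          using U0 by eventually_elim (simp add: k_def powr_divide powr_minus_divide)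
      qed
      finally show "(\<integral>\<^sup>+x. ennreal_powr (?M (A i *v x)) q \<partial>lebesgue) \<le> ennreal (D i) * (ennreal C * ?I)" .
    qed simp
    also have "\<dots> = ennreal (4 powr q * C * (\<Sum>i\<in>I. D i)) * ?I"
    proof -
      have "(\<Sum>i\<in>I. ennreal (4 powr q) * (ennreal (D i) * (ennreal C * ?I)))
          = (\<Sum>i\<in>I. (ennreal (4 powr q) * (ennreal C * ?I)) * ennreal (D i))"
        by (intro sum.cong refl) (simp only: mult_ac)
      also have "\<dots> = (ennreal (4 powr q) * (ennreal C * ?I)) * ennreal (\<Sum>i\<in>I. D i)"
        using D(1) by (simp add: sum_distrib_left[symmetric] sum_ennreal less_imp_le)
      also have "\<dots> = ennreal (4 powr q * C * (\<Sum>i\<in>I. D i)) * ?I"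
        using C D0 by (simp add: ennreal_mult mult_ac)
      finally show ?thesis .
    qed
    also have "\<dots> \<le> ennreal ?K * ?I" by (intro mult_right_mono ennreal_leI) auto
    finally show "(\<integral>\<^sup>+x. (\<Sum>i\<in>I. ennreal_powr (frac_maximal \<alpha> \<phi> h (A i *v x)) q) * ennreal (enn2real (Q x) powr (- (2 * q))) \<partial>lebesgue)
      \<le> ennreal ?K * ?I" .
  qed
qed

section \<open>Duality by absorption\<close>

lemma conjugate_exponents:
  fixes p q :: real
  assumes p: "1 < p" and pq: "1 / p + 1 / q = 1"
  shows "p * q = p + q" "1 < q"
proof -
  have "q \<noteq> 0" using p pq by auto
  then show pq': "p * q = p + q" using p pq by (simp add: field_simps)
  then have "(p - 1) * (q - 1) = 1" by (simp add: algebra_simps)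
  then have "0 < (p - 1) * (q - 1)" by simp
  then show "1 < q" using p by (simp add: zero_less_mult_iff)
qed

lemma Lc_infty_measurable: "f \<in> Lc_infty \<Longrightarrow> f \<in> borel_measurable lebesgue"
  by (simp add: Lc_infty_def)

text \<open>
  The test function is \<open>|T f|\<^sup>p u / T f\<close>, truncated to a bounded set where \<open>u\<close> and \<open>|T f|\<close> are
  bounded above and below; dividing by \<open>T f\<close> does the work of complex conjugation.
\<close>

lemma duality_bound:
  fixes T S :: "('a::euclidean_space \<Rightarrow> 'k::{real_normed_field, euclidean_space}) \<Rightarrow> 'a \<Rightarrow> 'k"
    and u :: "'a \<Rightarrow> real"
  assumes T: "linear_operator T" and adj: "adjoint_operator T S" and f: "f \<in> Lc_infty"
    and u[measurable]: "u \<in> borel_measurable lebesgue" and u0: "\<And>x. 0 \<le> u x"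
    and p: "1 < p" and pq: "1 / p + 1 / q = 1"
    and bound: "\<And>h. h \<in> Lc_infty \<Longrightarrow> (\<integral>\<^sup>+x. ennreal (norm (f x) * norm (S h x)) \<partial>lebesgue)
      \<le> X + ennreal (1 / 2) * (\<integral>\<^sup>+x. ennreal (norm (h x) powr q * u x powr (- q / p)) \<partial>lebesgue)"
  shows "(\<integral>\<^sup>+x. ennreal (norm (T f x) powr p * u x) \<partial>lebesgue) \<le> 2 * X"
proof -
  define g where "g = T f"
  have g[measurable]: "g \<in> borel_measurable lebesgue"
    using T f by (auto simp: g_def linear_operator_def locally_integrable_def)
  let ?F = "\<lambda>x. norm (g x) powr p * u x"
  \<comment> \<open>The bounds from both sides make ?F integrable on K n and the test function
    bounded with bounded support, and they allow division by g and negative powers of u.\<close>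
  define K where "K n = {x. norm x \<le> Suc n \<and> 1 / Suc n \<le> norm (g x) \<and> norm (g x) \<le> Suc n \<and>
      1 / Suc n \<le> u x \<and> u x \<le> Suc n}" for n :: nat
  have K[measurable]: "K n \<in> sets lebesgue" for n
  proof -
    have [measurable]: "(\<lambda>x::'a. norm x) \<in> borel_measurable lebesgue"
      by (intro borel_measurable_norm measurable_completion) simp
    have "{x \<in> space lebesgue. norm x \<le> Suc n \<and> 1 / Suc n \<le> norm (g x) \<and> norm (g x) \<le> Suc n \<and>
      1 / Suc n \<le> u x \<and> u x \<le> Suc n} \<in> sets lebesgue" by measurable
    then show ?thesis by (simp add: K_def)
  qed
  have K_pos: "0 < norm (g x)" "1 / norm (g x) \<le> Suc n" "0 < u x" if "x \<in> K n" for x n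
  proof -
    have *: "1 / real (Suc n) \<le> norm (g x)" "1 / real (Suc n) \<le> u x" "0 < 1 / real (Suc n)"
      using that by (simp_all add: K_def)
    then show pos: "0 < norm (g x)" "0 < u x" by linarith+
    from *(1) pos(1) show "1 / norm (g x) \<le> Suc n" by (simp add: field_simps)
  qed
  note q = conjugate_exponents[OF p pq]
  have part: "(\<integral>\<^sup>+x. ennreal (?F x) * indicator (K n) x \<partial>lebesgue) \<le> 2 * X" for n
  proof -
    define h where "h x = (if x \<in> K n then of_real (?F x) / g x else 0)" for x
    \<comment> \<open>The product is a nonnegative real multiple of 1, so the norm of the pairing is
      exactly the truncated integral of ?F.\<close>
    have gh: "g x * h x = (?F x * indicator (K n) x) *\<^sub>R 1" for x
      using K_pos[of x n] by (cases "x \<in> K n") (simp_all add: h_def scaleR_conv_of_real)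
    have Fb: "?F x \<le> Suc n powr p * Suc n" "0 \<le> ?F x" if "x \<in> K n" for x
      using that u0[of x] p by (auto simp: K_def intro!: mult_mono powr_mono2)
    have Fi: "integrable lebesgue (\<lambda>x. ?F x * indicator (K n) x)"
    proof -
      have "emeasure lebesgue (K n) \<le> emeasure lebesgue (cball (0::'a) (Suc n))"
        by (intro emeasure_mono) (auto simp: K_def)
      also have "\<dots> < \<infinity>" using emeasure_lborel_cball_finite[of 0 "Suc n"] by simp
      finally have fin: "emeasure lebesgue (K n) < \<infinity>" .
      have "integrable lebesgue (\<lambda>x. indicator (K n) x *\<^sub>R ?F x)"
        using Fb by (intro integrableI_bounded_set_indicator[OF K _ fin, where B = "Suc n powr p * Suc n"] AE_I2) auto
      then show ?thesis by (simp add: mult.commute)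
    qed
    have h_in: "h \<in> Lc_infty"
      unfolding Lc_infty_def
    proof (intro CollectI conjI)
      show "h \<in> borel_measurable lebesgue" unfolding h_def by measurable
      show "bounded (range h)"
      proof (rule boundedI)
        fix y assume "y \<in> range h"
        then obtain x where y: "y = h x" by blast
        show "norm y \<le> (Suc n powr p * Suc n) * Suc n"
        proof (cases "x \<in> K n")
          case True
          have "norm y = ?F x * (1 / norm (g x))"
            using True u0[of x] by (simp add: y h_def norm_divide norm_mult)
          also have "\<dots> \<le> (Suc n powr p * Suc n) * Suc n"
            using K_pos[OF True] by (intro mult_mono[OF Fb(1)[OF True]]) auto
          finally show ?thesis .
        qed (simp add: y h_def)
      qed
      have "closure {x. h x \<noteq> 0} \<subseteq> cball 0 (Suc n)"
        by (intro closure_minimal) (auto simp: h_def K_def)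
      then have "bounded (closure {x. h x \<noteq> 0})" by (rule bounded_subset[OF bounded_cball])
      then show "compact (closure {x. h x \<noteq> 0})" by (simp add: compact_eq_bounded_closed)
    qed
    have "(\<integral>\<^sup>+x. ennreal (?F x) * indicator (K n) x \<partial>lebesgue)
        = (\<integral>\<^sup>+x. ennreal (?F x * indicator (K n) x) \<partial>lebesgue)"
      by (intro nn_integral_cong) (auto simp: indicator_def)
    also have eq: "\<dots> = ennreal (\<integral>x. ?F x * indicator (K n) x \<partial>lebesgue)"
      using u0 by (intro nn_integral_eq_integral Fi AE_I2) auto
    also have "(\<integral>x. ?F x * indicator (K n) x \<partial>lebesgue) = norm (\<integral>x. g x * h x \<partial>lebesgue)"
    proof -
      have "(\<integral>x. g x * h x \<partial>lebesgue) = (\<integral>x. ?F x * indicator (K n) x \<partial>lebesgue) *\<^sub>R 1"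
        unfolding gh using Fi by (intro integral_scaleR_left) auto
      moreover have "0 \<le> (\<integral>x. ?F x * indicator (K n) x \<partial>lebesgue)"
        using u0 by (intro integral_nonneg_AE AE_I2) auto
      ultimately show ?thesis by simp
    qed
    also have "(\<integral>x. g x * h x \<partial>lebesgue) = (\<integral>x. f x * S h x \<partial>lebesgue)"
      using adj f h_in unfolding adjoint_operator_def g_def by blast
    also have "ennreal (norm (\<integral>x. f x * S h x \<partial>lebesgue)) \<le> (\<integral>\<^sup>+x. ennreal (norm (f x * S h x)) \<partial>lebesgue)"
    \<comment> \<open>If the product is not integrable, its Bochner integral is 0 by convention and
      the inequality is trivial.\<close>
    proof (cases "integrable lebesgue (\<lambda>x. f x * S h x)")
      case True
      then show ?thesis by (rule integral_norm_bound_ennreal)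
    qed (simp add: not_integrable_integral_eq)
    also have "\<dots> = (\<integral>\<^sup>+x. ennreal (norm (f x) * norm (S h x)) \<partial>lebesgue)" by (simp add: norm_mult)
    also have "\<dots> \<le> X + ennreal (1 / 2) * (\<integral>\<^sup>+x. ennreal (norm (h x) powr q * u x powr (- q / p)) \<partial>lebesgue)"
      by (rule bound[OF h_in])
    also have "(\<integral>\<^sup>+x. ennreal (norm (h x) powr q * u x powr (- q / p)) \<partial>lebesgue)
        = (\<integral>\<^sup>+x. ennreal (?F x * indicator (K n) x) \<partial>lebesgue)"
    proof (rule nn_integral_cong)
      fix x
      show "ennreal (norm (h x) powr q * u x powr (- q / p)) = ennreal (?F x * indicator (K n) x)"
      proof (cases "x \<in> K n")
        case True
        note pos = K_pos(1,3)[OF True]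
        \<comment> \<open>The test function is extremal: since (p - 1) q = p and q - q/p = 1, its
          own dual modular equals the integral to be estimated, which therefore appears on both
          sides.\<close>
        have "norm (h x) = norm (g x) powr (p - 1) * u x"
          using True pos by (simp add: h_def norm_divide powr_diff norm_mult)
        then have "norm (h x) powr q * u x powr (- q / p)
            = norm (g x) powr ((p - 1) * q) * (u x powr q * u x powr (- q / p))"
          using pos by (simp add: powr_mult powr_powr)
        also have "u x powr q * u x powr (- q / p) = u x powr (q + - q / p)"
          by (rule powr_add[symmetric])
        also have "q + - q / p = 1" using q p by (simp add: field_simps)
        also have "(p - 1) * q = p" using q by (simp add: algebra_simps)
        finally show ?thesis using True pos by simp
      qed (simp add: h_def)
    qed
    also have "\<dots> = ennreal (\<integral>x. ?F x * indicator (K n) x \<partial>lebesgue)" by (rule eq)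
    finally have le: "(\<integral>\<^sup>+x. ennreal (?F x) * indicator (K n) x \<partial>lebesgue)
        \<le> X + ennreal (1 / 2) * ennreal (\<integral>x. ?F x * indicator (K n) x \<partial>lebesgue)" .
    have eq2: "(\<integral>\<^sup>+x. ennreal (?F x) * indicator (K n) x \<partial>lebesgue)
        = ennreal (\<integral>x. ?F x * indicator (K n) x \<partial>lebesgue)"
      unfolding eq[symmetric] by (intro nn_integral_cong) (auto simp: indicator_def)
    have nn: "0 \<le> (\<integral>x. ?F x * indicator (K n) x \<partial>lebesgue)"
      using u0 by (intro integral_nonneg_AE AE_I2) auto
    show ?thesis
    \<comment> \<open>The truncated integral is finite, so half of it can be moved to the left; this
      produces the factor 2 in front of X.\<close>
    proof (cases X)
      case (real X')
      let ?i = "\<integral>x. ?F x * indicator (K n) x \<partial>lebesgue"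
      have "ennreal ?i \<le> X + ennreal (1 / 2) * ennreal ?i" using le unfolding eq2 .
      also have "\<dots> = ennreal (X' + 1 / 2 * ?i)"
        unfolding real(2) using real(1) nn by (subst ennreal_plus, simp, simp, subst ennreal_mult) simp_all
      finally have "?i \<le> X' + 1 / 2 * ?i" using real(1) nn by (subst (asm) ennreal_le_iff) simp_all
      then have "ennreal ?i \<le> ennreal (2 * X')" by (intro ennreal_leI) simp
      then show ?thesis unfolding eq2 real(2) using real(1) by (simp add: ennreal_mult)
    qed (simp add: ennreal_mult_top)
  qed
  have "(\<integral>\<^sup>+x. ennreal (?F x) \<partial>lebesgue) \<le> (\<integral>\<^sup>+x. (SUP n. ennreal (?F x) * indicator (K n) x) \<partial>lebesgue)"
  proof (rule nn_integral_mono)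
    fix x
    show "ennreal (?F x) \<le> (SUP n. ennreal (?F x) * indicator (K n) x)"
    \<comment> \<open>Points with g x = 0 or u x = 0 belong to no K n, but ?F vanishes there. Any
      other point belongs to K n once n exceeds all the quantities in ?M.\<close>
    proof (cases "g x = 0 \<or> u x = 0")
      case False
      let ?M = "max (norm x) (max (norm (g x)) (max (1 / norm (g x)) (max (u x) (1 / u x))))"
      obtain n :: nat where n: "?M \<le> real n" using real_arch_simple by blast
      have pos: "0 < norm (g x)" "0 < u x" using False u0[of x] by auto
      have "1 / norm (g x) \<le> Suc n" "1 / u x \<le> Suc n" using n by auto
      then have "1 / Suc n \<le> norm (g x)" "1 / Suc n \<le> u x" using pos by (simp_all add: field_simps)
      then have "x \<in> K n" using n by (simp add: K_def)
      then show ?thesis by (intro SUP_upper2[of n]) auto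
    qed auto
  qed
  also have "\<dots> = (SUP n. \<integral>\<^sup>+x. ennreal (?F x) * indicator (K n) x \<partial>lebesgue)"
  proof (rule nn_integral_monotone_convergence_SUP)
    have "K m \<subseteq> K n" if "m \<le> n" for m n
    proof -
      have "1 / real (Suc n) \<le> 1 / real (Suc m)" "real (Suc m) \<le> real (Suc n)"
        using that by (simp_all add: field_simps)
      then show ?thesis unfolding K_def by auto
    qed
    then show "incseq (\<lambda>n x. ennreal (?F x) * indicator (K n) x)"
      by (auto simp: incseq_def le_fun_def indicator_def)
    show "(\<lambda>x. ennreal (?F x) * indicator (K n) x) \<in> borel_measurable lebesgue" for n by measurable
  qed
  also have "\<dots> \<le> 2 * X" by (intro SUP_least part)
  finally show ?thesis by (simp add: g_def)
qed

section \<open>Assembly of the dual estimate\<close>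

theorem theorem3p4:
  fixes \<phi> \<E> \<F> \<D> :: "real \<Rightarrow> real"
    and \<alpha> p p' :: real
    and m :: nat
    and A :: "nat \<Rightarrow> real ^ 'n ^ 'n"
    and T Tadj :: "(real ^ 'n \<Rightarrow> 'k::{real_normed_field, euclidean_space}) \<Rightarrow> real ^ 'n \<Rightarrow> 'k"
  assumes "young_function \<phi>"
    and "0 \<le> \<alpha>" and "\<alpha> < real CARD('n)"
    and "1 < p" and "1 / p + 1 / p' = 1"
    and "1 \<le> m"
    and "\<forall>i\<in>{1..m}. invertible (A i)"
    and "\<forall>i\<in>{1..m}. \<forall>j\<in>{1..m}. i \<noteq> j \<longrightarrow> invertible (A i - A j)"
    and "young_function \<E>" and "young_function \<F>"
    and "B_class p' \<E>"
    and "\<forall>t\<ge>0. young_inverse \<E> t * young_inverse \<F> t \<le> young_inverse \<phi> t"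
    and "\<D> = (\<lambda>t. \<F> (t powr (1 / p)))"
    and "linear_operator T"
    and "adjoint_operator T Tadj"
    and "\<forall>q>0. \<forall>w\<in>A_infinity. \<exists>c>0. \<forall>f\<in>Lc_infty.
           (\<integral>\<^sup>+x. ennreal (norm (Tadj f x) powr q * w x) \<partial>lebesgue)
           \<le> ennreal c * (\<integral>\<^sup>+x. (\<Sum>i=1..m. ennreal_powr (frac_maximal \<alpha> \<phi> f (A i *v x)) q)
                                  * ennreal (w x) \<partial>lebesgue)"
  shows "\<forall>u::real ^ 'n \<Rightarrow> real. weight u \<longrightarrow>
           (\<exists>c>0. \<forall>f\<in>Lc_infty.
             (\<integral>\<^sup>+x. ennreal (norm (T f x) powr p * u x) \<partial>lebesgue)
             \<le> ennreal c * (\<integral>\<^sup>+x. ennreal (norm (f x) powr p)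
                                    * (\<Sum>i=1..m. frac_maximal (\<alpha> * p) \<D> u (A i *v x)) \<partial>lebesgue))"
proof (intro allI impI)
  fix u :: "real ^ 'n \<Rightarrow> real" assume "weight u"
  then have u0: "\<And>x. 0 \<le> u x" and u[measurable]: "u \<in> borel_measurable lebesgue"
    and u_pos: "AE x in lebesgue. 0 < u x" by (auto simp: weight_def locally_integrable_def)
  note \<phi> = assms(1) and p = assms(4) and pq = assms(5) and \<E> = assms(9) and \<F> = assms(10)
  note duality = duality_bound[OF assms(14,15) _ u u0 p pq]
  have p': "1 < p'" by (rule conjugate_exponents(2)[OF p pq])
  define U where "U x = u x powr (1 / p)" for x
  have U[measurable]: "U \<in> borel_measurable lebesgue" unfolding U_def by measurable
  have U_pos: "AE x in lebesgue. 0 < U x" using u_pos by eventually_elim (simp add: U_def)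
  then have U_nz: "AE x in lebesgue. U x \<noteq> 0" by (rule eventually_mono) simp
  let ?P = "frac_maximal \<alpha> \<F> U" and ?N = "\<lambda>x. \<Sum>i=1..m. frac_maximal (\<alpha> * p) \<D> u (A i *v x)"
  have PN: "ennreal_powr (?P x) p \<le> frac_maximal (\<alpha> * p) \<D> u x" for x
    unfolding assms(13) U_def using p u0 by (intro frac_maximal_powr_le) auto
  show "\<exists>c>0. \<forall>f\<in>Lc_infty. (\<integral>\<^sup>+x. ennreal (norm (T f x) powr p * u x) \<partial>lebesgue)
      \<le> ennreal c * (\<integral>\<^sup>+x. ennreal (norm (f x) powr p) * ?N x \<partial>lebesgue)"
  proof (cases "\<exists>x. ?P x < \<infinity>")
    case False
    then have P_top: "?P x = top" for x by (simp add: not_less top_unique)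
    have "frac_maximal (\<alpha> * p) \<D> u x = top" for x using PN[of x] by (simp add: P_top top_unique)
    moreover have "(\<Sum>i=1..m. top) = (top :: ennreal)"
      using assms(6) by (simp add: ennreal_mult_top)
    ultimately have N_top: "?N x = top" for x by simp
    show ?thesis
    proof (intro exI[of _ 1] conjI ballI)
      fix f :: "real ^ 'n \<Rightarrow> 'k" assume f: "f \<in> Lc_infty"
      note [measurable] = Lc_infty_measurable[OF f]
      let ?R = "\<integral>\<^sup>+x. ennreal (norm (f x) powr p) * ?N x \<partial>lebesgue"
      show "(\<integral>\<^sup>+x. ennreal (norm (T f x) powr p * u x) \<partial>lebesgue) \<le> ennreal 1 * ?R"
      proof (cases "?R = top")
        case False
        then have "(\<integral>\<^sup>+x. ennreal (norm (f x) powr p) * top \<partial>lebesgue) \<noteq> \<infinity>" unfolding N_top by simp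
        then have "AE x in lebesgue. ennreal (norm (f x) powr p) * top \<noteq> \<infinity>"
          by (intro nn_integral_noteq_infinite) measurable
        then have f0: "AE x in lebesgue. f x = 0"
          by eventually_elim (auto simp: ennreal_mult_top ennreal_eq_0_iff split: if_splits)
        \<comment> \<open>An operator acts on functions and not on classes modulo null sets, so f =
          0 almost everywhere does not give T f = 0 by linearity. The adjoint identity does: every
          pairing with T f is 0, which is the duality bound with X = 0.\<close>
        have "(\<integral>\<^sup>+x. ennreal (norm (T f x) powr p * u x) \<partial>lebesgue) \<le> 2 * 0"
        proof (rule duality[OF f])
          fix h :: "real ^ 'n \<Rightarrow> 'k"
          have "(\<integral>\<^sup>+x. ennreal (norm (f x) * norm (Tadj h x)) \<partial>lebesgue) = (\<integral>\<^sup>+x. 0 \<partial>(lebesgue :: (real ^ 'n) measure))"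
            using f0 by (intro nn_integral_cong_AE) (auto elim: eventually_mono)
          then show "(\<integral>\<^sup>+x. ennreal (norm (f x) * norm (Tadj h x)) \<partial>lebesgue) \<le> 0 +
            ennreal (1 / 2) * (\<integral>\<^sup>+x. ennreal (norm (h x) powr p' * u x powr (- p' / p)) \<partial>lebesgue)" by simp
        qed
        then show ?thesis by simp
      qed simp
    qed simp
  next
    case True
    then obtain x0 where x0: "?P x0 < \<infinity>" by blast
    define G where "G i x = ennreal_powr (?P (A i *v x)) (1 / 2)" for i x
    define Q where "Q = (\<lambda>x. \<Sum>i\<in>{1..m}. G i x)"
    have P_borel[measurable]: "?P \<in> borel_measurable borel" by (rule borel_measurable_frac_maximal)
    have G: "G i \<in> borel_measurable lebesgue" for i
    proof -
      have [measurable]: "(\<lambda>x. A i *v x) \<in> borel_measurable borel"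
        by (intro borel_measurable_continuous_onI matrix_vector_mult_linear_continuous_on)
      have "G i \<in> borel_measurable lborel" unfolding G_def by measurable
      then show ?thesis by (rule measurable_completion)
    qed
    have Q[measurable]: "Q \<in> borel_measurable lebesgue"
      unfolding Q_def by (intro borel_measurable_sum G)
    obtain C where C: "0 < C" "a1_bound C (\<lambda>x. ennreal_powr (?P x) (1 / 2))"
      using frac_maximal_half_power_a1[OF \<F> assms(2) U U_nz] by blast
    have Ga1: "\<exists>C>0. a1_bound C (G i)" if "i \<in> {1..m}" for i
      unfolding G_def using assms(7) that by (intro a1_bound_matrix[OF _ _ C]) auto
    have "AE x in lebesgue. G i x < \<infinity>" if i: "i \<in> {1..m}" for i
    proof -
      have "invertible (A i)" using assms(7) i by blast
      \<comment> \<open>The point x0 where P is finite is pulled back by a right inverse of A i,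
        giving a point where G i is finite; the A_1 bound then spreads finiteness to almost every
        point.\<close>
      then obtain B where "A i ** B = mat 1" unfolding invertible_def by blast
      then have "G i (B *v x0) < \<infinity>" using x0 by (simp add: G_def matrix_vector_mul_assoc top.not_eq_extremum[symmetric])
      with Ga1[OF i] G show ?thesis using a1_bound_AE_finite by blast
    qed
    then have "AE x in lebesgue. \<forall>i\<in>{1..m}. G i x < \<infinity>" by (intro AE_finite_allI) auto
    then have Q_fin: "AE x in lebesgue. Q x < \<infinity>"
      by eventually_elim (auto simp: Q_def less_top)
    have Q_pos: "0 < Q x" for x
    proof -
      have "0 < G 1 x" using frac_maximal_pos[OF \<F> U U_nz] by (simp add: G_def)
      also have "G 1 x \<le> Q x" unfolding Q_def using assms(6) by (intro member_le_sum) auto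
      finally show ?thesis .
    qed
    obtain C' where C': "0 < C'" "a1_bound C' Q"
      unfolding Q_def using a1_bound_sum[of "{1..m}" G] G Ga1 by auto
    let ?w = "\<lambda>x. enn2real (Q x) powr (- (2 * p'))"
    have w: "?w \<in> A_infinity"
      using p' by (intro A_infinity_negative_power[OF Q Q_pos Q_fin C']) auto
    have p'0: "0 < p'" using p' by simp
    obtain c1 where c1: "0 < c1" "\<And>h. h \<in> Lc_infty \<Longrightarrow>
        (\<integral>\<^sup>+x. ennreal (norm (Tadj h x) powr p' * ?w x) \<partial>lebesgue)
        \<le> ennreal c1 * (\<integral>\<^sup>+x. (\<Sum>i=1..m. ennreal_powr (frac_maximal \<alpha> \<phi> h (A i *v x)) p') * ennreal (?w x) \<partial>lebesgue)"
      using assms(16)[rule_format, OF p'0 w] by blast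
    have "\<exists>C>0. \<forall>h::real ^ 'n \<Rightarrow> 'k. h \<in> borel_measurable lebesgue \<longrightarrow>
        (\<integral>\<^sup>+x. (\<Sum>i=1..m. ennreal_powr (frac_maximal \<alpha> \<phi> h (A i *v x)) p') * ennreal (?w x) \<partial>lebesgue)
        \<le> ennreal C * (\<integral>\<^sup>+x. ennreal (norm (h x) powr p' * U x powr (- p')) \<partial>lebesgue)"
      using assms(7) by (intro maximal_weighted_bound[OF \<phi> \<E> \<F> assms(12,11) p' _ _ U U_pos _ Q_fin])
        (auto simp: Q_def G_def)
    then obtain c2 where c2: "0 < c2" "\<And>h::real ^ 'n \<Rightarrow> 'k. h \<in> borel_measurable lebesgue \<Longrightarrow>
        (\<integral>\<^sup>+x. (\<Sum>i=1..m. ennreal_powr (frac_maximal \<alpha> \<phi> h (A i *v x)) p') * ennreal (?w x) \<partial>lebesgue)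
        \<le> ennreal c2 * (\<integral>\<^sup>+x. ennreal (norm (h x) powr p' * U x powr (- p')) \<partial>lebesgue)"
      by blast
    \<comment> \<open>Solves e^(-p') c1 c2 = 1/2, so that the dual term in Young's inequality has
      exactly the coefficient which \<open>duality_bound\<close> absorbs.\<close>
    define e where "e = (2 * c1 * c2) powr (1 / p')"
    have e: "0 < e" "e powr (- p') * (c1 * c2) = 1 / 2"
      using c1(1) c2(1) p' by (simp_all add: e_def powr_powr powr_minus field_simps)
    let ?R = "\<lambda>f::real ^ 'n \<Rightarrow> 'k. \<integral>\<^sup>+x. ennreal (norm (f x) powr p) * ?N x \<partial>lebesgue"
    let ?K = "e powr p * m powr (2 * p)"
    \<comment> \<open>Q is at most m times its largest summand, so Q^(2p) is at most m^(2p) times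
      P(A_j x)^p for some j. Where Q x = top, \<open>enn2real\<close> gives 0 and the left-hand side
      vanishes.\<close>
    have QN: "ennreal (enn2real (Q x) powr (2 * p)) \<le> ennreal (m powr (2 * p)) * ?N x" for x
    proof -
      have "finite ((\<lambda>i. G i x) ` {1..m})" "(\<lambda>i. G i x) ` {1..m} \<noteq> {}" using assms(6) by auto
      from Max_in[OF this] obtain j where j: "j \<in> {1..m}" "Max ((\<lambda>i. G i x) ` {1..m}) = G j x" by auto
      have "Q x \<le> (\<Sum>i\<in>{1..m}. G j x)"
        unfolding Q_def j(2)[symmetric] by (intro sum_mono Max_ge) auto
      also have "\<dots> = ennreal m * G j x" by (simp add: ennreal_of_nat_eq_real_of_nat)
      finally have "ennreal_powr (Q x) (2 * p) \<le> ennreal_powr (ennreal m * G j x) (2 * p)"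
        using p by (intro ennreal_powr_mono) auto
      also have "\<dots> = ennreal (m powr (2 * p)) * ennreal_powr (?P (A j *v x)) p"
        by (simp add: ennreal_powr_mult ennreal_powr_ennreal ennreal_powr_powr G_def)
      also have "\<dots> \<le> ennreal (m powr (2 * p)) * ?N x"
      proof (rule mult_left_mono)
        note PN[of "A j *v x"]
        also have "frac_maximal (\<alpha> * p) \<D> u (A j *v x) \<le> ?N x" using j(1) by (intro member_le_sum) auto
        finally show "ennreal_powr (?P (A j *v x)) p \<le> ?N x" .
      qed simp
      finally have "ennreal_powr (Q x) (2 * p) \<le> ennreal (m powr (2 * p)) * ?N x" .
      then show ?thesis by (cases "Q x") (auto simp: ennreal_powr_ennreal)
    qed
    show ?thesis
    proof (intro exI[of _ "2 * ?K"] conjI ballI)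
      show "0 < 2 * ?K" using e(1) assms(6) by simp
      fix f :: "real ^ 'n \<Rightarrow> 'k" assume f: "f \<in> Lc_infty"
      note fm[measurable] = Lc_infty_measurable[OF f]
      have "(\<integral>\<^sup>+x. ennreal (norm (T f x) powr p * u x) \<partial>lebesgue) \<le> 2 * (ennreal ?K * ?R f)"
      proof (rule duality[OF f])
        fix h :: "real ^ 'n \<Rightarrow> 'k" assume h: "h \<in> Lc_infty"
        have Sh[measurable]: "Tadj h \<in> borel_measurable lebesgue"
          using assms(15) h by (auto simp: adjoint_operator_def linear_operator_def locally_integrable_def)
        let ?J = "\<integral>\<^sup>+x. ennreal (norm (h x) powr p' * u x powr (- p' / p)) \<partial>lebesgue"
        have "AE x in lebesgue. ennreal (norm (f x) * norm (Tadj h x))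
          \<le> ennreal (e powr p) * ennreal (norm (f x) powr p * enn2real (Q x) powr (2 * p))
            + ennreal (e powr (- p')) * ennreal (norm (Tadj h x) powr p' * ?w x)"
          using Q_fin
        proof eventually_elim
          fix x assume "Q x < \<infinity>"
          define s where "s = enn2real (Q x) powr 2"
          have s: "0 < s" using \<open>Q x < \<infinity>\<close> Q_pos[of x] by (cases "Q x") (auto simp: s_def)
          have s_powr: "s powr r = enn2real (Q x) powr (2 * r)" for r
            by (simp only: s_def powr_powr)
          \<comment> \<open>With s the square of Q, the factor that makes Young's inequality produce
            Q^(2p) next to |f|^p and the weight Q^(-2p') next to |T^*h|^p'. Almost everywhere s is
            positive and finite, so dividing by it is harmless.\<close>
          let ?a = "norm (f x) * (e * s)" and ?b = "norm (Tadj h x) / (e * s)"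
          have "norm (f x) * norm (Tadj h x) = ?a * ?b" using e(1) s by simp
          also have "\<dots> \<le> ?a powr p / p + ?b powr p' / p'"
            using e(1) s p p' pq by (intro Youngs_inequality) auto
          \<comment> \<open>The divisors p and p' exceed 1 and are dropped, which keeps the equation
            for e simple.\<close>
          also have "\<dots> \<le> ?a powr p + ?b powr p'"
            using p p' by (intro add_mono) (simp_all add: divide_le_eq mult_le_cancel_left1)
          also have "?a powr p = e powr p * (norm (f x) powr p * enn2real (Q x) powr (2 * p))"
            using e(1) s by (simp add: powr_mult s_powr)
          also have "?b powr p' = e powr (- p') * (norm (Tadj h x) powr p' * ?w x)"
            using e(1) s by (simp add: powr_mult powr_divide s_powr powr_minus_divide)
          finally have "norm (f x) * norm (Tadj h x) \<le> e powr p * (norm (f x) powr p * enn2real (Q x) powr (2 * p))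
            + e powr (- p') * (norm (Tadj h x) powr p' * ?w x)" .
          then have "ennreal (norm (f x) * norm (Tadj h x)) \<le> ennreal (e powr p * (norm (f x) powr p * enn2real (Q x) powr (2 * p))
            + e powr (- p') * (norm (Tadj h x) powr p' * ?w x))" by (rule ennreal_leI)
          then show "ennreal (norm (f x) * norm (Tadj h x))
            \<le> ennreal (e powr p) * ennreal (norm (f x) powr p * enn2real (Q x) powr (2 * p))
              + ennreal (e powr (- p')) * ennreal (norm (Tadj h x) powr p' * ?w x)"
            by (simp add: ennreal_plus ennreal_mult'[symmetric] del: ennreal_plus[symmetric])
        qed
        then have "(\<integral>\<^sup>+x. ennreal (norm (f x) * norm (Tadj h x)) \<partial>lebesgue)
          \<le> (\<integral>\<^sup>+x. ennreal (e powr p) * ennreal (norm (f x) powr p * enn2real (Q x) powr (2 * p))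
            + ennreal (e powr (- p')) * ennreal (norm (Tadj h x) powr p' * ?w x) \<partial>lebesgue)"
          by (rule nn_integral_mono_AE)
        also have "\<dots> = ennreal (e powr p) * (\<integral>\<^sup>+x. ennreal (norm (f x) powr p * enn2real (Q x) powr (2 * p)) \<partial>lebesgue)
            + ennreal (e powr (- p')) * (\<integral>\<^sup>+x. ennreal (norm (Tadj h x) powr p' * ?w x) \<partial>lebesgue)"
          by (subst nn_integral_add, measurable, (subst nn_integral_cmult, measurable)+)
        also have "\<dots> \<le> ennreal (e powr p) * (ennreal (m powr (2 * p)) * ?R f)
            + ennreal (e powr (- p')) * (ennreal c1 * (ennreal c2 * ?J))"
        proof (intro add_mono mult_left_mono)
          have "(\<integral>\<^sup>+x. ennreal (norm (f x) powr p * enn2real (Q x) powr (2 * p)) \<partial>lebesgue)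
            \<le> (\<integral>\<^sup>+x. ennreal (m powr (2 * p)) * (ennreal (norm (f x) powr p) * ?N x) \<partial>lebesgue)"
          proof (rule nn_integral_mono)
            fix x
            show "ennreal (norm (f x) powr p * enn2real (Q x) powr (2 * p))
              \<le> ennreal (m powr (2 * p)) * (ennreal (norm (f x) powr p) * ?N x)"
              using mult_left_mono[OF QN[of x], of "ennreal (norm (f x) powr p)"]
              by (simp add: ennreal_mult mult_ac)
          qed
          also have "\<dots> = ennreal (m powr (2 * p)) * ?R f"
          proof (rule nn_integral_cmult)
            have [measurable]: "(\<lambda>x. A i *v x) \<in> borel_measurable borel" for i
              by (intro borel_measurable_continuous_onI matrix_vector_mult_linear_continuous_on)
            have [measurable]: "frac_maximal (\<alpha> * p) \<D> u \<in> borel_measurable borel"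
              by (rule borel_measurable_frac_maximal)
            have "?N \<in> borel_measurable lborel" by measurable
            then have "?N \<in> borel_measurable lebesgue" by (rule measurable_completion)
            moreover have "(\<lambda>x. ennreal (norm (f x) powr p)) \<in> borel_measurable lebesgue" by measurable
            ultimately show "(\<lambda>x. ennreal (norm (f x) powr p) * ?N x) \<in> borel_measurable lebesgue"
              by (intro borel_measurable_times_ennreal)
          qed
          finally show "(\<integral>\<^sup>+x. ennreal (norm (f x) powr p * enn2real (Q x) powr (2 * p)) \<partial>lebesgue)
            \<le> ennreal (m powr (2 * p)) * ?R f" .
          have "U x powr (- p') = u x powr (- p' / p)" for x by (simp add: U_def powr_powr)
          then have "(\<integral>\<^sup>+x. (\<Sum>i=1..m. ennreal_powr (frac_maximal \<alpha> \<phi> h (A i *v x)) p') * ennreal (?w x) \<partial>lebesgue)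
              \<le> ennreal c2 * ?J"
            using c2(2)[OF Lc_infty_measurable[OF h]] by simp
          then show "(\<integral>\<^sup>+x. ennreal (norm (Tadj h x) powr p' * ?w x) \<partial>lebesgue) \<le> ennreal c1 * (ennreal c2 * ?J)"
            using c1(2)[OF h] by (blast intro: order_trans mult_left_mono zero_le)
        qed simp_all
        also have "ennreal (e powr p) * (ennreal (m powr (2 * p)) * ?R f) = ennreal ?K * ?R f"
          by (simp add: ennreal_mult mult.assoc)
        also have "ennreal (e powr (- p')) * (ennreal c1 * (ennreal c2 * ?J)) = ennreal (e powr (- p') * (c1 * c2)) * ?J"
          using c1(1) c2(1) by (simp add: ennreal_mult mult.assoc)
        finally show "(\<integral>\<^sup>+x. ennreal (norm (f x) * norm (Tadj h x)) \<partial>lebesgue)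
          \<le> ennreal ?K * ?R f + ennreal (1 / 2) * ?J" unfolding e(2) .
      qed
      then show "(\<integral>\<^sup>+x. ennreal (norm (T f x) powr p * u x) \<partial>lebesgue) \<le> ennreal (2 * ?K) * ?R f"
        by (simp add: ennreal_mult mult.assoc)
    qed
  qed
qed

end
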